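(* Let $K$ be a field and let $L_3$ be the three-dimensional Leibniz algebra over $K$ with basis $\{e_1,e_2,e_3\}$ and nonzero products of basis elements $e_3e_3=e_1$, $e_3e_2=e_2$, $e_2e_3=-e_2$. Put \[ S_1=\{x_1x_2x_3+x_2x_1x_3,\ \ x_3x_1x_2-x_3x_2x_1-x_2x_1x_3,\ \ (x_1x_2)(x_3x_4)\}, \] \[ S_2=\{x_1x_2+x_2x_1,\ \ (x_1x_2)(x_3x_4)\}. \] Suppose first that $K$ is infinite. (1) If $\operatorname{char}(K)\ne 2$, then $S_1$ generates the $T$-ideal of polynomial identities of $L_3$. (2) If $\operatorname{char}(K)=2$, then $S_2$ generates the $T$-ideal of polynomial identities of $L_3$. Furthermore, if $K$ is a finite field of cardinality $|K|=q$, then the $T$-ideal of polynomial identities of $L_3$ is generated by the corresponding set ($S_1$ if $\operatorname{char}(K)\neq 2$, $S_2$ if $\operatorname{char}(K)=2$) together with the polynomials \[ x_1x_2-x_2x_1+2x_2x_1x_2^{(q-1)}+2x_2x_1^{(q)}-2x_2x_1^{(q)}x_2^{(q-1)}, \] \[ x_1x_2x_3^{(q)}-x_1x_2x_3, \] \[ x_3x_1x_2-x_3x_1^{(q)}x_2-x_3x_1x_3^{(q-1)}x_2+x_3x_1^{(q)}x_3^{(q-1)}x_2 . \]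
   Context: A (right) Leibniz algebra over $K$ is a $K$-algebra satisfying $x(yz)=(xy)z-(xz)y$. Identities live in the free Leibniz algebra $\mathcal L\langle X\rangle$ over $K$ on $X=\{x_1,x_2,\dots\}$; the $T$-ideal of identities of $L$ is the set of polynomials vanishing under all substitutions of elements of $L$. A $T$-ideal is an ideal invariant under all endomorphisms of $\mathcal L\langle X\rangle$, and it is generated by $S$ if it is the smallest $T$-ideal containing $S$. Products without brackets are left-normed, and $x^{(m)}$ means $m$ consecutive occurrences of $x$ in a left-normed product (e.g. $x_2x_1^{(q)}x_2^{(q-1)}$ is $x_2$ multiplied on the right successively $q$ times by $x_1$ and then $q-1$ times by $x_2$). Products of basis elements not listed are zero. *)

theory Defs
  imports "HOL-Analysis.Analysis" "HOL-Library.Poly_Mapping"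
begin

section \<open>Algebras, ideals and homomorphisms\<close>

locale nonassoc_algebra = vector_space scale
  for scale :: "'k::field \<Rightarrow> 'a::ab_group_add \<Rightarrow> 'a" +
  fixes mul :: "'a \<Rightarrow> 'a \<Rightarrow> 'a"
  assumes mul_add_left: "mul (x + y) z = mul x z + mul y z"
    and mul_add_right: "mul x (y + z) = mul x y + mul x z"
    and mul_scale_left: "mul (scale c x) y = scale c (mul x y)"
    and mul_scale_right: "mul x (scale c y) = scale c (mul x y)"
begin

definition ideal :: "'a set \<Rightarrow> bool" where
  "ideal I \<longleftrightarrow> subspace I \<and> (\<forall>a\<in>I. \<forall>x. mul a x \<in> I \<and> mul x a \<in> I)"

lemma mul_zero_left [simp]: "mul 0 x = 0"
  using mul_add_left[of 0 0 x] by simp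

lemma mul_zero_right [simp]: "mul x 0 = 0"
  using mul_add_right[of x 0 0] by simp

lemma mul_diff_left: "mul (x - y) z = mul x z - mul y z"
  using mul_add_left[of "x - y" y z] by (simp add: algebra_simps)

lemma mul_diff_right: "mul x (y - z) = mul x y - mul x z"
  using mul_add_right[of x "y - z" z] by (simp add: algebra_simps)

lemma mul_sum_left: "mul (\<Sum>i\<in>A. f i) y = (\<Sum>i\<in>A. mul (f i) y)"
  by (induction A rule: infinite_finite_induct) (auto simp: mul_add_left)

lemma mul_sum_right: "mul x (\<Sum>i\<in>A. f i) = (\<Sum>i\<in>A. mul x (f i))"
  by (induction A rule: infinite_finite_induct) (auto simp: mul_add_right)

lemma ideal_hull: "ideal (ideal hull S)"
  by (rule hull_in) (auto simp: ideal_def subspace_def)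

end

locale leibniz_algebra = nonassoc_algebra scale mul
  for scale :: "'k::field \<Rightarrow> 'a::ab_group_add \<Rightarrow> 'a" and mul :: "'a \<Rightarrow> 'a \<Rightarrow> 'a" +
  assumes leibniz: "mul x (mul y z) = mul (mul x y) z - mul (mul x z) y"

definition algebra_hom ::
  "('k::field \<Rightarrow> 'a::ab_group_add \<Rightarrow> 'a) \<Rightarrow> ('a \<Rightarrow> 'a \<Rightarrow> 'a) \<Rightarrow>
   ('k \<Rightarrow> 'b::ab_group_add \<Rightarrow> 'b) \<Rightarrow> ('b \<Rightarrow> 'b \<Rightarrow> 'b) \<Rightarrow> ('a \<Rightarrow> 'b) \<Rightarrow> bool" where
  "algebra_hom s1 m1 s2 m2 \<phi> \<longleftrightarrow>
     Vector_Spaces.linear s1 s2 \<phi> \<and> (\<forall>x y. \<phi> (m1 x y) = m2 (\<phi> x) (\<phi> y))"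


section \<open>The free nonassociative algebra\<close>

datatype magma = Gen nat | Mul magma magma

definition na_scale :: "'k::field \<Rightarrow> (magma \<Rightarrow>\<^sub>0 'k) \<Rightarrow> (magma \<Rightarrow>\<^sub>0 'k)" where
  "na_scale c p = Poly_Mapping.map ((*) c) p"

definition na_mul :: "(magma \<Rightarrow>\<^sub>0 'k::field) \<Rightarrow> (magma \<Rightarrow>\<^sub>0 'k) \<Rightarrow> (magma \<Rightarrow>\<^sub>0 'k)" where
  "na_mul p q = (\<Sum>a\<in>Poly_Mapping.keys p. \<Sum>b\<in>Poly_Mapping.keys q.
     Poly_Mapping.single (Mul a b) (Poly_Mapping.lookup p a * Poly_Mapping.lookup q b))"

lemma lookup_na_scale [simp]:
  "Poly_Mapping.lookup (na_scale c p) m = c * Poly_Mapping.lookup p m"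
  by (simp add: na_scale_def Poly_Mapping.map.rep_eq when_def)

lemma na_scale_single [simp]: "na_scale c (Poly_Mapping.single m d) = Poly_Mapping.single m (c * d)"
  by (rule poly_mapping_eqI) (simp add: lookup_single when_def)

lemma vector_space_na_scale: "vector_space na_scale"
  by standard (auto intro!: poly_mapping_eqI simp: lookup_add algebra_simps)

lemma na_expand:
  assumes "finite A" "Poly_Mapping.keys p \<subseteq> A"
  shows "p = (\<Sum>m\<in>A. Poly_Mapping.single m (Poly_Mapping.lookup p m))"
proof (rule poly_mapping_eqI)
  fix k
  show "Poly_Mapping.lookup p k =
      Poly_Mapping.lookup (\<Sum>m\<in>A. Poly_Mapping.single m (Poly_Mapping.lookup p m)) k"
    using assms by (auto simp: lookup_sum lookup_single when_def in_keys_iff subset_iff)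
qed

definition lin_ext :: "('k \<Rightarrow> 'b \<Rightarrow> 'b) \<Rightarrow> ('m \<Rightarrow> 'b::comm_monoid_add) \<Rightarrow> ('m \<Rightarrow>\<^sub>0 'k::zero) \<Rightarrow> 'b" where
  "lin_ext s v p = (\<Sum>m\<in>Poly_Mapping.keys p. s (Poly_Mapping.lookup p m) (v m))"

context vector_space
begin

lemma lin_ext_superset:
  fixes p :: "'m \<Rightarrow>\<^sub>0 'a"
  assumes "finite A" "Poly_Mapping.keys p \<subseteq> A"
  shows "lin_ext scale v p = (\<Sum>m\<in>A. scale (Poly_Mapping.lookup p m) (v m))"
  unfolding lin_ext_def using assms
  by (intro sum.mono_neutral_left) (auto simp: in_keys_iff)

lemma lin_ext_add: "lin_ext scale v (p + q) = lin_ext scale v p + lin_ext scale v q"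
proof -
  let ?A = "Poly_Mapping.keys p \<union> Poly_Mapping.keys q"
  have "Poly_Mapping.keys (p + q) \<subseteq> ?A" by (rule keys_add)
  then show ?thesis
    by (simp add: lin_ext_superset[of ?A] lookup_add scale_left_distrib sum.distrib)
qed

lemma lin_ext_single [simp]: "lin_ext scale v (Poly_Mapping.single m c) = scale c (v m)"
  by (subst lin_ext_superset[of "{m}"]) auto

lemma lin_ext_zero [simp]: "lin_ext scale v 0 = 0"
  by (simp add: lin_ext_def)

lemma lin_ext_sum: "lin_ext scale v (\<Sum>i\<in>A. f i) = (\<Sum>i\<in>A. lin_ext scale v (f i))"
  by (induction A rule: infinite_finite_induct) (auto simp: lin_ext_add)

lemma lin_ext_na_scale: "lin_ext scale v (na_scale c p) = scale c (lin_ext scale v p)"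
proof -
  have "Poly_Mapping.keys (na_scale c p) \<subseteq> Poly_Mapping.keys p"
    by (auto simp: in_keys_iff)
  then show ?thesis
    by (simp add: lin_ext_superset[of "Poly_Mapping.keys p"] scale_sum_right)
qed

end

lemma na_scale_sum: "na_scale c (\<Sum>i\<in>A. f i) = (\<Sum>i\<in>A. na_scale c (f i))"
  by (rule poly_mapping_eqI) (simp add: lookup_sum sum_distrib_left)

lemma na_mul_lin_ext_left:
  "na_mul p q = lin_ext na_scale
     (\<lambda>a. \<Sum>b\<in>Poly_Mapping.keys q. Poly_Mapping.single (Mul a b) (Poly_Mapping.lookup q b)) p"
  by (simp add: na_mul_def lin_ext_def na_scale_sum)

lemma na_mul_lin_ext_right:
  "na_mul p q = lin_ext na_scale
     (\<lambda>b. \<Sum>a\<in>Poly_Mapping.keys p. Poly_Mapping.single (Mul a b) (Poly_Mapping.lookup p a)) q"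
  unfolding na_mul_def
  by (subst sum.swap) (simp add: lin_ext_def na_scale_sum mult.commute)

global_interpretation na: nonassoc_algebra na_scale na_mul
proof -
  interpret vector_space "na_scale :: 'a \<Rightarrow> _" by (rule vector_space_na_scale)
  show "nonassoc_algebra (na_scale :: 'a \<Rightarrow> _) na_mul"
  proof
    fix x y z :: "magma \<Rightarrow>\<^sub>0 'a" and c :: 'a
    show "na_mul (x + y) z = na_mul x z + na_mul y z"
      by (simp only: na_mul_lin_ext_left lin_ext_add)
    show "na_mul (na_scale c x) y = na_scale c (na_mul x y)"
      by (simp only: na_mul_lin_ext_left lin_ext_na_scale)
    show "na_mul x (y + z) = na_mul x y + na_mul x z"
      by (simp only: na_mul_lin_ext_right lin_ext_add)
    show "na_mul x (na_scale c y) = na_scale c (na_mul x y)"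
      by (simp only: na_mul_lin_ext_right lin_ext_na_scale)
  qed
qed

lemma na_mul_single [simp]:
  "na_mul (Poly_Mapping.single a c) (Poly_Mapping.single b d) = Poly_Mapping.single (Mul a b) (c * d)"
  by (cases "c = 0"; cases "d = 0") (auto simp: na_mul_def)


section \<open>The free Leibniz algebra\<close>

definition leibniz_ideal :: "(magma \<Rightarrow>\<^sub>0 'k::field) set" where
  "leibniz_ideal = na.ideal hull
     {na_mul x (na_mul y z) - (na_mul (na_mul x y) z - na_mul (na_mul x z) y) | x y z. True}"

definition leibniz_rel :: "(magma \<Rightarrow>\<^sub>0 'k::field) \<Rightarrow> (magma \<Rightarrow>\<^sub>0 'k) \<Rightarrow> bool" where
  "leibniz_rel p q \<longleftrightarrow> p - q \<in> leibniz_ideal"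

lemma ideal_leibniz_ideal: "na.ideal leibniz_ideal"
  unfolding leibniz_ideal_def by (rule na.ideal_hull)

lemma subspace_leibniz_ideal: "na.subspace leibniz_ideal"
  using ideal_leibniz_ideal unfolding na.ideal_def by blast

lemma equivp_leibniz_rel: "equivp leibniz_rel"
proof (rule equivpI)
  show "reflp leibniz_rel"
    using na.subspace_0[OF subspace_leibniz_ideal] by (auto simp: reflp_def leibniz_rel_def)
  show "symp leibniz_rel"
    using na.subspace_neg[OF subspace_leibniz_ideal]
    by (force simp: symp_def leibniz_rel_def)
  show "transp leibniz_rel"
    using na.subspace_add[OF subspace_leibniz_ideal]
    by (force simp: transp_def leibniz_rel_def)
qed

quotient_type (overloaded) 'k free_leibniz = "magma \<Rightarrow>\<^sub>0 'k::field" / leibniz_rel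
  by (rule equivp_leibniz_rel)

instantiation free_leibniz :: (field) ab_group_add
begin

lift_definition zero_free_leibniz :: "'a free_leibniz" is 0 .

lift_definition plus_free_leibniz :: "'a free_leibniz \<Rightarrow> 'a free_leibniz \<Rightarrow> 'a free_leibniz" is "(+)"
  using na.subspace_add[OF subspace_leibniz_ideal] by (force simp: leibniz_rel_def add_diff_add)

lift_definition uminus_free_leibniz :: "'a free_leibniz \<Rightarrow> 'a free_leibniz" is uminus
  using na.subspace_neg[OF subspace_leibniz_ideal] by (force simp: leibniz_rel_def)

lift_definition minus_free_leibniz :: "'a free_leibniz \<Rightarrow> 'a free_leibniz \<Rightarrow> 'a free_leibniz" is "(-)"
  using na.subspace_diff[OF subspace_leibniz_ideal]
  by (force simp: leibniz_rel_def algebra_simps)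

instance
  by standard
    (transfer; simp add: algebra_simps equivp_reflp[OF equivp_leibniz_rel])+

end

lift_definition fl_scale :: "'k::field \<Rightarrow> 'k free_leibniz \<Rightarrow> 'k free_leibniz" is na_scale
  using na.subspace_scale[OF subspace_leibniz_ideal]
  by (force simp: leibniz_rel_def simp flip: na.scale_right_diff_distrib)

lift_definition fl_mul ::
  "'k::field free_leibniz \<Rightarrow> 'k free_leibniz \<Rightarrow> 'k free_leibniz" (infixl "\<cdot>" 70) is na_mul
proof -
  fix p p' q q' :: "magma \<Rightarrow>\<^sub>0 'k"
  assume "leibniz_rel p p'" "leibniz_rel q q'"
  then have "na_mul (p - p') q + na_mul p' (q - q') \<in> leibniz_ideal"
    using ideal_leibniz_ideal na.subspace_add[OF subspace_leibniz_ideal]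
    by (auto simp: leibniz_rel_def na.ideal_def)
  then show "leibniz_rel (na_mul p q) (na_mul p' q')"
    by (simp add: leibniz_rel_def na.mul_diff_left na.mul_diff_right)
qed

lift_definition gen :: "nat \<Rightarrow> 'k::field free_leibniz" is "\<lambda>n. Poly_Mapping.single (Gen n) 1" .

global_interpretation fl: leibniz_algebra fl_scale fl_mul
proof
  note refl = equivp_reflp[OF equivp_leibniz_rel]
  fix x y z :: "'a free_leibniz" and a b :: 'a
  show "fl_scale a (x + y) = fl_scale a x + fl_scale a y"
    by transfer (simp add: na.scale_right_distrib refl)
  show "fl_scale (a + b) x = fl_scale a x + fl_scale b x"
    by transfer (simp add: na.scale_left_distrib refl)
  show "fl_scale a (fl_scale b x) = fl_scale (a * b) x"
    by transfer (simp add: refl)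
  show "fl_scale 1 x = x"
    by transfer (simp add: refl)
  show "(x + y) \<cdot> z = x \<cdot> z + y \<cdot> z"
    by transfer (simp add: na.mul_add_left refl)
  show "x \<cdot> (y + z) = x \<cdot> y + x \<cdot> z"
    by transfer (simp add: na.mul_add_right refl)
  show "fl_scale a x \<cdot> y = fl_scale a (x \<cdot> y)"
    by transfer (simp add: na.mul_scale_left refl)
  show "x \<cdot> fl_scale a y = fl_scale a (x \<cdot> y)"
    by transfer (simp add: na.mul_scale_right refl)
  show "x \<cdot> (y \<cdot> z) = x \<cdot> y \<cdot> z - x \<cdot> z \<cdot> y"
  proof (transfer, unfold leibniz_rel_def)
    fix x y z :: "magma \<Rightarrow>\<^sub>0 'a"
    show "na_mul x (na_mul y z) - (na_mul (na_mul x y) z - na_mul (na_mul x z) y) \<in> leibniz_ideal"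
      unfolding leibniz_ideal_def by (rule subsetD[OF hull_subset]) blast
  qed
qed

lemma free_leibniz_cases: obtains p where "x = abs_free_leibniz p"
  using Quotient3_abs_rep[OF Quotient3_free_leibniz, of x] by metis

lemma abs_free_leibniz_single:
  "abs_free_leibniz (Poly_Mapping.single m c) = fl_scale c (abs_free_leibniz (Poly_Mapping.single m 1))"
  by (simp add: fl_scale.abs_eq)

lemma free_leibniz_induct [case_names zero add scale gen mul]:
  assumes zero: "P 0"
    and add: "\<And>x y. P x \<Longrightarrow> P y \<Longrightarrow> P (x + y)"
    and scale: "\<And>c x. P x \<Longrightarrow> P (fl_scale c x)"
    and gen: "\<And>n. P (gen n)"
    and mul: "\<And>x y. P x \<Longrightarrow> P y \<Longrightarrow> P (x \<cdot> y)"
  shows "P x"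
proof -
  have monom: "P (abs_free_leibniz (Poly_Mapping.single w 1))" for w
  proof (induction w)
    case (Gen n)
    show ?case using gen[of n] by (simp add: gen_def)
  next
    case (Mul a b)
    then have "P (abs_free_leibniz (Poly_Mapping.single a 1) \<cdot> abs_free_leibniz (Poly_Mapping.single b 1))"
      by (rule mul)
    then show ?case by (simp add: fl_mul.abs_eq)
  qed
  obtain p where x: "x = abs_free_leibniz p" by (rule free_leibniz_cases)
  have "P (abs_free_leibniz (\<Sum>w\<in>A. Poly_Mapping.single w (Poly_Mapping.lookup p w)))" if "finite A" for A
    using that
  proof (induction A rule: finite_induct)
    case empty
    then show ?case using zero by (simp add: zero_free_leibniz_def)
  next
    case (insert w A)
    have "P (fl_scale (Poly_Mapping.lookup p w) (abs_free_leibniz (Poly_Mapping.single w 1)))"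
      by (rule scale[OF monom])
    with insert show ?case
      using add by (simp add: abs_free_leibniz_single[of w "Poly_Mapping.lookup p w"] flip: plus_free_leibniz.abs_eq)
  qed
  from this[of "Poly_Mapping.keys p"] show ?thesis
    by (simp add: x flip: na_expand[of "Poly_Mapping.keys p" p])
qed

primrec magma_eval :: "('a \<Rightarrow> 'a \<Rightarrow> 'a) \<Rightarrow> (nat \<Rightarrow> 'a) \<Rightarrow> magma \<Rightarrow> 'a" where
  "magma_eval m v (Gen n) = v n"
| "magma_eval m v (Mul a b) = m (magma_eval m v a) (magma_eval m v b)"

theorem free_leibniz_universal:
  fixes s :: "'k::field \<Rightarrow> 'a::ab_group_add \<Rightarrow> 'a"
  assumes "leibniz_algebra s m"
  shows "\<exists>!\<phi>. algebra_hom fl_scale fl_mul s m \<phi> \<and> (\<forall>n. \<phi> (gen n) = v n)"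
proof (rule ex_ex1I)
  interpret L: leibniz_algebra s m by fact
  define E where "E = lin_ext s (magma_eval m v)"
  have E_add: "E (p + q) = E p + E q" for p q
    by (simp add: E_def L.lin_ext_add)
  have E_scale: "E (na_scale c p) = s c (E p)" for c p
    by (simp add: E_def L.lin_ext_na_scale)
  have E_diff: "E (p - q) = E p - E q" for p q
    using E_add[of "p - q" q] by (simp add: algebra_simps)
  have E_mul: "E (na_mul p q) = m (E p) (E q)" for p q
    unfolding E_def na_mul_def
    by (simp add: L.lin_ext_sum)
      (simp add: lin_ext_def L.mul_sum_left L.mul_sum_right L.mul_scale_left L.mul_scale_right
        L.scale_sum_right mult.commute, subst sum.swap, rule refl)
  have "na.ideal {p. E p = 0}"
    unfolding na.ideal_def na.subspace_def
    by (auto simp: E_add E_scale E_mul) (simp add: E_def)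
  then have "leibniz_ideal \<subseteq> {p. E p = 0}"
    unfolding leibniz_ideal_def
    by (intro hull_minimal) (auto simp: E_diff E_mul L.leibniz)
  then have E_rel: "E p = E q" if "leibniz_rel p q" for p q
    using that E_diff[of p q] by (auto simp: leibniz_rel_def)
  define \<phi> where "\<phi> x = E (rep_free_leibniz x)" for x
  have \<phi>_abs: "\<phi> (abs_free_leibniz p) = E p" for p
    unfolding \<phi>_def
    by (intro E_rel Quotient3_rep_abs[OF Quotient3_free_leibniz] equivp_reflp[OF equivp_leibniz_rel])
  have "\<phi> (x + y) = \<phi> x + \<phi> y" "\<phi> (fl_scale c x) = s c (\<phi> x)" "\<phi> (x \<cdot> y) = m (\<phi> x) (\<phi> y)" for x y c
    by (rule free_leibniz_cases[of x]; rule free_leibniz_cases[of y];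
        simp add: \<phi>_abs plus_free_leibniz.abs_eq fl_scale.abs_eq fl_mul.abs_eq E_add E_scale E_mul)+
  moreover have "\<phi> (gen n) = v n" for n
    by (simp add: gen_def \<phi>_abs E_def)
  ultimately have "algebra_hom fl_scale fl_mul s m \<phi> \<and> (\<forall>n. \<phi> (gen n) = v n)"
    unfolding algebra_hom_def
    by (auto intro!: Vector_Spaces.linear.intro module_hom_axioms.intro module_hom.intro
      fl.vector_space_axioms L.vector_space_axioms fl.module_axioms L.module_axioms)
  then show "\<exists>\<phi>. algebra_hom fl_scale fl_mul s m \<phi> \<and> (\<forall>n. \<phi> (gen n) = v n)" by blast
next
  fix \<phi> \<psi>
  assume \<phi>: "algebra_hom fl_scale fl_mul s m \<phi> \<and> (\<forall>n. \<phi> (gen n) = v n)"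
    and \<psi>: "algebra_hom fl_scale fl_mul s m \<psi> \<and> (\<forall>n. \<psi> (gen n) = v n)"
  then have "module_hom fl_scale s \<phi>" "module_hom fl_scale s \<psi>"
    by (simp_all add: algebra_hom_def module_hom_iff_linear)
  note hom = this[THEN module_hom.add] this[THEN module_hom.scale] this[THEN module_hom.zero]
  have "\<phi> x = \<psi> x" for x
    by (induction x rule: free_leibniz_induct) (use \<phi> \<psi> in \<open>auto simp: hom algebra_hom_def\<close>)
  then show "\<phi> = \<psi>" by blast
qed


section \<open>Identities and T-ideals\<close>

text \<open>By \<open>free_leibniz_universal\<close>, the homomorphisms from the free Leibniz algebra to a Leibniz
  algebra are exactly the substitutions of its elements for the generators.\<close>

definition identities ::
  "('k::field \<Rightarrow> 'a::ab_group_add \<Rightarrow> 'a) \<Rightarrow> ('a \<Rightarrow> 'a \<Rightarrow> 'a) \<Rightarrow> 'k free_leibniz set" where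
  "identities s m = {f. \<forall>\<phi>. algebra_hom fl_scale fl_mul s m \<phi> \<longrightarrow> \<phi> f = 0}"

definition T_ideal :: "'k::field free_leibniz set \<Rightarrow> bool" where
  "T_ideal I \<longleftrightarrow> fl.ideal I \<and>
     (\<forall>\<phi>. algebra_hom fl_scale fl_mul fl_scale fl_mul \<phi> \<longrightarrow> \<phi> ` I \<subseteq> I)"

lemma T_ideal_hull: "T_ideal (T_ideal hull S)"
proof (rule hull_in)
  fix \<T> :: "'a free_leibniz set set"
  assume *: "Ball \<T> T_ideal"
  then have "fl.ideal (\<Inter>\<T>)"
    by (auto simp: T_ideal_def fl.ideal_def fl.subspace_def)
  with * show "T_ideal (\<Inter>\<T>)"
    unfolding T_ideal_def by blast
qed


section \<open>The algebra \<open>L\<^sub>3\<close>\<close>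

text \<open>Structure constants: \<open>L3_table i j\<close> is the product \<open>e\<^sub>i e\<^sub>j\<close>, where \<open>e\<^sub>i\<close> is
  \<open>axis i 1\<close>. In the index type \<open>3\<close>, the numeral \<open>3\<close> denotes the third element (it equals \<open>0\<close>).\<close>

definition L3_table :: "3 \<Rightarrow> 3 \<Rightarrow> 'k::field ^ 3" where
  "L3_table i j =
     (if i = 3 \<and> j = 3 then axis 1 1
      else if i = 3 \<and> j = 2 then axis 2 1
      else if i = 2 \<and> j = 3 then - axis 2 1
      else 0)"

definition L3_mul :: "'k::field ^ 3 \<Rightarrow> 'k ^ 3 \<Rightarrow> 'k ^ 3" where
  "L3_mul u v = (\<Sum>i\<in>UNIV. \<Sum>j\<in>UNIV. (u $ i * v $ j) *s L3_table i j)"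

lemma L3_mul_nth:
  "L3_mul u v $ 1 = u $ 3 * v $ 3"
  "L3_mul u v $ 2 = u $ 3 * v $ 2 - u $ 2 * v $ 3"
  "L3_mul u v $ 3 = 0"
  by (simp_all add: L3_mul_def L3_table_def sum_3 axis_def)

global_interpretation L3: leibniz_algebra "(*s)" L3_mul
  by standard (simp_all add: vec_eq_iff forall_3 L3_mul_nth algebra_simps)


section \<open>The generating polynomials\<close>

text \<open>\<open>y \<cdot> x\<^bsup>(n)\<^esup>\<close> is \<open>y\<close> multiplied on the right \<open>n\<close> times by \<open>x\<close>; since \<open>\<cdot>\<close> associates to
  the left, unbracketed products are left-normed.\<close>

definition rmul_pow :: "'k::field free_leibniz \<Rightarrow> 'k free_leibniz \<Rightarrow> nat \<Rightarrow> 'k free_leibniz"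
    ("_ \<cdot> _\<^bsup>'(_')\<^esup>" [70, 71, 0] 70) where
  "y \<cdot> x\<^bsup>(n)\<^esup> = ((\<lambda>z. z \<cdot> x) ^^ n) y"

text \<open>The generators are numbered from \<open>0\<close>, so \<open>x\<^sub>i\<close> is \<open>gen (i - 1)\<close>.\<close>

abbreviation x1 :: "'k::field free_leibniz" where "x1 \<equiv> gen 0"
abbreviation x2 :: "'k::field free_leibniz" where "x2 \<equiv> gen 1"
abbreviation x3 :: "'k::field free_leibniz" where "x3 \<equiv> gen 2"
abbreviation x4 :: "'k::field free_leibniz" where "x4 \<equiv> gen 3"

definition S1 :: "'k::field free_leibniz set" where
  "S1 = {x1 \<cdot> x2 \<cdot> x3 + x2 \<cdot> x1 \<cdot> x3,
         x3 \<cdot> x1 \<cdot> x2 - x3 \<cdot> x2 \<cdot> x1 - x2 \<cdot> x1 \<cdot> x3,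
         (x1 \<cdot> x2) \<cdot> (x3 \<cdot> x4)}"

definition S2 :: "'k::field free_leibniz set" where
  "S2 = {x1 \<cdot> x2 + x2 \<cdot> x1, (x1 \<cdot> x2) \<cdot> (x3 \<cdot> x4)}"

definition S_fin :: "nat \<Rightarrow> 'k::field free_leibniz set" where
  "S_fin q =
    {x1 \<cdot> x2 - x2 \<cdot> x1 + fl_scale 2 (x2 \<cdot> x1 \<cdot> x2\<^bsup>(q - 1)\<^esup>) + fl_scale 2 (x2 \<cdot> x1\<^bsup>(q)\<^esup>)
       - fl_scale 2 (x2 \<cdot> x1\<^bsup>(q)\<^esup> \<cdot> x2\<^bsup>(q - 1)\<^esup>),
     x1 \<cdot> x2 \<cdot> x3\<^bsup>(q)\<^esup> - x1 \<cdot> x2 \<cdot> x3,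
     x3 \<cdot> x1 \<cdot> x2 - x3 \<cdot> x1\<^bsup>(q)\<^esup> \<cdot> x2 - x3 \<cdot> x1 \<cdot> x3\<^bsup>(q - 1)\<^esup> \<cdot> x2
       + x3 \<cdot> x1\<^bsup>(q)\<^esup> \<cdot> x3\<^bsup>(q - 1)\<^esup> \<cdot> x2}"

end

(* The elements x y z ... of L_3^2 behave like b_i a_j - a_i b_j times a monomial in the b_k, where
   (c_k, a_k, b_k) are the coordinates of the value of x_k. Modulo the stated polynomials, the right
   multiplications by the generators commute on the square of the free algebra, and the Jacobi
   identity x_k [i, j] = x_i [k, j] - x_j [k, i] allows one index of the leading bracket to be chosen.
   Linear terms and the terms x_i x_j with i <= j are detected by the coordinate along e_1.

   Over an infinite field, fixing the first index within each multidegree gives a normal form whose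
   values are distinct monomials, which are independent by Dedekind's lemma on characters.

   Over a field with q elements, let f be an identity in the span of products of length at least 3.
   Moving x_k to the front and applying Dedekind's lemma to monomials with reduced exponents shows
   f x_k x_k = 0 modulo the T-ideal, and f x_k = 0 then follows from x_k^q = x_k. So f is
   fixed by every operator 1 - x_k^(q-1), whereas the product of these operators annihilates every
   product of length at least 3. *)

theory Submission
  imports Defs
begin

section \<open>Linear combinations and characters\<close>

text \<open>Restricting to a subset on which \<open>f\<close> is injective turns a combination of
  vectors into one of indices, even when \<open>f\<close> repeats values.\<close>

lemma (in vector_space) span_image_sum:
  assumes "h \<in> span (f ` S)"
  obtains A d where "finite A" "A \<subseteq> S" "h = (\<Sum>p\<in>A. scale (d p) (f p))"
proof -
  from assms obtain t r where t: "finite t" "t \<subseteq> f ` S" "h = (\<Sum>a\<in>t. scale (r a) a)"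
    by (auto simp: span_explicit)
  from t(2) obtain A where A: "A \<subseteq> S" "inj_on f A" "t = f ` A"
    by (auto simp: subset_image_inj)
  show thesis
  proof (rule that)
    show "finite A" using t(1) A finite_imageD by blast
    show "A \<subseteq> S" by fact
    show "h = (\<Sum>p\<in>A. scale ((r \<circ> f) p) (f p))"
      using t(3) A by (simp add: sum.reindex)
  qed
qed

lemma (in vector_space) subspace_span_Un:
  assumes "subspace I" "h \<in> span (S \<union> I)"
  obtains g where "g \<in> span S" "h - g \<in> I"
proof -
  from assms(2) obtain x y where "h = x + y" "x \<in> span S" "y \<in> span I"
    by (auto simp: span_Un)
  with assms(1) that[of x] show thesis by (simp add: span_eq_iff[THEN iffD2])
qed

text \<open>Dedekind's argument: subtracting a multiple of a translate of the relation removes one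
  character.\<close>

lemma characters_independent:
  fixes op :: "'m \<Rightarrow> 'm \<Rightarrow> 'm" and C :: "('m \<Rightarrow> 'k::field) set"
  assumes "finite C"
    and "\<And>f x y. f \<in> C \<Longrightarrow> f (op x y) = f x * f y"
    and "\<And>f. f \<in> C \<Longrightarrow> \<exists>x. f x \<noteq> 0"
    and "\<And>x. (\<Sum>f\<in>C. d f * f x) = 0" and "f \<in> C"
  shows "d f = 0"
  using assms
proof (induction C arbitrary: d f rule: finite_induct)
  case empty
  then show ?case by simp
next
  case (insert g C)
  have zero: "d f = 0" if "f \<in> C" for f
  proof -
    from that insert.hyps obtain y where y: "f y \<noteq> g y" by (metis ext)
    have "(\<Sum>f\<in>C. (d f * (f y - g y)) * f x) = 0" for x
    proof -
      have "(\<Sum>f\<in>C. (d f * (f y - g y)) * f x) =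
          (\<Sum>f\<in>C. d f * f (op x y)) - g y * (\<Sum>f\<in>C. d f * f x)"
        unfolding sum_distrib_left sum_subtractf[symmetric]
        by (intro sum.cong refl) (simp add: insert.prems(1) algebra_simps)
      also have "\<dots> = (\<Sum>f\<in>insert g C. d f * f (op x y)) - g y * (\<Sum>f\<in>insert g C. d f * f x)"
        using insert.hyps insert.prems(1) by (simp add: algebra_simps)
      also have "\<dots> = 0" using insert.prems(3) by simp
      finally show ?thesis .
    qed
    then have "d f * (f y - g y) = 0"
      using insert.IH[of "\<lambda>f. d f * (f y - g y)" f] insert.prems that by blast
    with y show ?thesis by simp
  qed
  moreover obtain x where "g x \<noteq> 0" using insert.prems(2) by blast
  moreover from insert.prems(3)[of x] zero insert.hyps have "d g * g x = 0"
    by simp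
  ultimately show ?case using insert.prems(4) by auto
qed

section \<open>Monomials as functions on substitutions\<close>

abbreviation monom_val :: "nat list \<Rightarrow> (nat \<Rightarrow> 'k::field) \<Rightarrow> 'k" where
  "monom_val ks b \<equiv> prod_list (map b ks)"

text \<open>Multiplicativity makes each monomial function a character of the monoid of functions
  under pointwise multiplication.\<close>

lemma monom_val_mult: "monom_val ks (\<lambda>n. b n * c n) = monom_val ks b * monom_val ks c"
  by (induction ks) (auto simp: algebra_simps)

lemma monom_val_one: "monom_val ks (\<lambda>_. 1) = 1"
  by (induction ks) auto

lemma monom_val_upd: "monom_val ks ((\<lambda>_. 1)(k := t)) = t ^ count (mset ks) k"
  by (induction ks) auto

lemma monom_val_perm: "mset ks = mset ms \<Longrightarrow> monom_val ks b = monom_val ms b"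
  by (metis mset_map prod_mset_prod_list)

text \<open>Different words may define the same function, so Dedekind's lemma is applied to the set
  of distinct functions; it controls only the total coefficient of each.\<close>

lemma sum_monom_val_group:
  fixes m :: "'s \<Rightarrow> nat list" and d :: "'s \<Rightarrow> 'k::field"
  assumes "finite S" and "\<And>b. (\<Sum>s\<in>S. d s * monom_val (m s) b) = 0" and "s0 \<in> S"
  shows "(\<Sum>s | s \<in> S \<and> (monom_val (m s) :: _ \<Rightarrow> 'k) = monom_val (m s0). d s) = 0"
proof -
  let ?X = "\<lambda>s. monom_val (m s) :: (nat \<Rightarrow> 'k) \<Rightarrow> 'k"
  have "(\<Sum>f\<in>?X ` S. (\<Sum>s | s \<in> S \<and> ?X s = f. d s) * f b) = 0" for b
  proof -
    have "(\<Sum>f\<in>?X ` S. (\<Sum>s | s \<in> S \<and> ?X s = f. d s) * f b) =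
        (\<Sum>f\<in>?X ` S. \<Sum>s | s \<in> S \<and> ?X s = f. d s * ?X s b)"
      unfolding sum_distrib_right by (intro sum.cong refl) auto
    also have "\<dots> = (\<Sum>s\<in>S. d s * ?X s b)"
      using sum.image_gen[OF assms(1), of "\<lambda>s. d s * ?X s b" ?X] by simp
    finally show ?thesis using assms(2) by simp
  qed
  then show ?thesis
    by (intro characters_independent[of "?X ` S" "\<lambda>b c n. b n * c n"
          "\<lambda>f. \<Sum>s | s \<in> S \<and> ?X s = f. d s"])
      (use assms(1,3) in \<open>auto simp: monom_val_mult monom_val_one intro!: exI[of _ "\<lambda>_. 1"]\<close>)
qed

text \<open>Otherwise \<open>p\<close> is a nonzero polynomial vanishing on the whole field, which
  has more elements than the degree allows.\<close>

lemma power_fun_eqD: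
  fixes m n :: nat
  assumes "\<And>t::'k::field. t ^ m = t ^ n"
    and "infinite (UNIV :: 'k set) \<or> m < CARD('k) \<and> n < CARD('k)"
  shows "m = n"
proof (rule ccontr)
  assume "m \<noteq> n"
  define p where "p = monom (1::'k) m - monom 1 n"
  have "coeff p m = 1" using \<open>m \<noteq> n\<close> by (simp add: p_def)
  then have "p \<noteq> 0" by auto
  moreover have "{t. poly p t = 0} = UNIV" using assms(1) by (auto simp: p_def poly_monom)
  ultimately have fin: "finite (UNIV :: 'k set)" and "CARD('k) \<le> degree p"
    using poly_roots_finite[of p] card_poly_roots_bound[of p] by auto
  moreover have "degree p \<le> max m n"
    unfolding p_def by (intro degree_diff_le) (auto simp: degree_monom_eq)
  ultimately show False using assms(2) by auto
qed

lemma monom_val_eqD: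
  assumes "(monom_val ks :: (nat \<Rightarrow> 'k::field) \<Rightarrow> 'k) = monom_val ms"
    and "infinite (UNIV :: 'k set) \<or>
      (\<forall>k. count (mset ks) k < CARD('k) \<and> count (mset ms) k < CARD('k))"
  shows "mset ks = mset ms"
proof (rule multiset_eqI)
  fix k
  \<comment> \<open>Setting every variable but \<open>k\<close> to 1 isolates the exponent of
    \<open>k\<close>.\<close>
  have "t ^ count (mset ks) k = t ^ count (mset ms) k" for t :: 'k
    using fun_cong[OF assms(1), of "(\<lambda>_. 1)(k := t)"] by (simp only: monom_val_upd)
  then show "count (mset ks) k = count (mset ms) k"
    by (rule power_fun_eqD) (use assms(2) in auto)
qed

text \<open>Multiplication by a nonzero \<open>x\<close> permutes the nonzero elements, and
  comparing their products gives the power. The bound makes the exponent positive, which settles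
  \<open>x = 0\<close>.\<close>

lemma finite_field_fermat:
  fixes x :: "'k::field"
  assumes "finite (UNIV :: 'k set)"
  shows "x ^ (CARD('k) - 1) = (if x = 0 then 0 else 1)" "CARD('k) \<ge> 2"
proof -
  have "card {0, 1::'k} \<le> CARD('k)" by (intro card_mono assms) auto
  then show *: "CARD('k) \<ge> 2" by simp
  show "x ^ (CARD('k) - 1) = (if x = 0 then 0 else 1)"
  proof (cases "x = 0")
    case True
    with * show ?thesis by simp
  next
    case False
    have fin: "finite (UNIV - {0::'k})" using assms by (rule finite_subset[rotated]) auto
    have "(\<Prod>y\<in>UNIV - {0::'k}. x * y) = (\<Prod>y\<in>UNIV - {0}. y)"
      by (rule prod.reindex_bij_witness[of _ "\<lambda>y. y / x" "\<lambda>y. x * y"]) (use False in auto)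
    moreover have "(\<Prod>y\<in>UNIV - {0::'k}. x * y) = x ^ (CARD('k) - 1) * (\<Prod>y\<in>UNIV - {0}. y)"
      using assms by (simp add: prod.distrib card_Diff_singleton)
    moreover have "(\<Prod>y\<in>UNIV - {0::'k}. y) \<noteq> 0" using fin by simp
    ultimately show ?thesis using False by simp
  qed
qed

lemma two_neq_0_iff: "(2::'k::field) \<noteq> 0 \<longleftrightarrow> CHAR('k) \<noteq> 2"
proof -
  have "CHAR('k) \<noteq> 1" using of_nat_eq_0_iff_char_dvd[of 1, where 'a = 'k] by auto
  moreover have "CHAR('k) dvd 2 \<longleftrightarrow> CHAR('k) = 1 \<or> CHAR('k) = 2"
    using two_is_prime_nat prime_nat_iff by auto
  ultimately show ?thesis using of_nat_eq_0_iff_char_dvd[of 2, where 'a = 'k] by auto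
qed


section \<open>Right multiplications by generators\<close>

text \<open>The sign makes the action of \<open>x\<^sub>k\<close> on \<open>L\<^sub>3\<^sup>2\<close> multiplication by the third coordinate.\<close>

definition ract :: "nat \<Rightarrow> 'k::field free_leibniz \<Rightarrow> 'k free_leibniz" where
  "ract k z = - (z \<cdot> gen k)"

abbreviation ractl :: "nat list \<Rightarrow> 'k::field free_leibniz \<Rightarrow> 'k free_leibniz" where
  "ractl ks z \<equiv> fold ract ks z"

lemma ract_add: "ract k (x + y) = ract k x + ract k y"
  by (simp add: ract_def fl.mul_add_left)

lemma ract_diff: "ract k (x - y) = ract k x - ract k y"
  by (simp add: ract_def fl.mul_diff_left)

lemma ract_zero [simp]: "ract k 0 = 0"
  by (simp add: ract_def)

lemma ract_scale: "ract k (fl_scale c x) = fl_scale c (ract k x)"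
  by (simp add: ract_def fl.mul_scale_left)

lemma ractl_add: "ractl ks (x + y) = ractl ks x + ractl ks y"
  by (induction ks arbitrary: x y) (simp_all add: ract_add)

lemma ractl_diff: "ractl ks (x - y) = ractl ks x - ractl ks y"
  by (induction ks arbitrary: x y) (simp_all add: ract_diff)

lemma ractl_zero [simp]: "ractl ks 0 = 0"
  by (induction ks) simp_all

lemma ractl_scale: "ractl ks (fl_scale c x) = fl_scale c (ractl ks x)"
  by (induction ks arbitrary: x) (simp_all add: ract_scale)

lemma subspace_ractl_vimage:
  assumes "fl.subspace U" shows "fl.subspace {z. ractl ks z \<in> U}"
  using assms by (auto simp: fl.subspace_def ractl_add ractl_scale)

lemma subspace_ract_vimage:
  assumes "fl.subspace U" shows "fl.subspace {z. ract k z \<in> U}"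
  using subspace_ractl_vimage[OF assms, of "[k]"] by simp

text \<open>The power of -1 undoes the signs built into \<open>ract\<close>.\<close>

lemma rmul_pow_eq_ractl: "z \<cdot> gen k\<^bsup>(n)\<^esup> = fl_scale ((- 1) ^ n) (ractl (replicate n k) z)"
proof (induction n)
  case (Suc n)
  let ?z = "ractl (replicate n k) z"
  have "z \<cdot> gen k\<^bsup>(Suc n)\<^esup> = (z \<cdot> gen k\<^bsup>(n)\<^esup>) \<cdot> gen k"
    by (simp add: rmul_pow_def)
  also have "\<dots> = fl_scale ((- 1) ^ Suc n) (ract k ?z)"
    by (simp only: Suc ract_def[of k ?z] fl.mul_scale_left power_Suc) simp
  also have "ract k ?z = ractl (replicate (Suc n) k) z"
    by (simp add: funpow_swap1)
  finally show ?case .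
qed (simp add: rmul_pow_def)

section \<open>The square of the free algebra and its determinant-like elements\<close>

definition products :: "'k::field free_leibniz set" where
  "products = fl.span {x \<cdot> y | x y. True}"

lemma subspace_products: "fl.subspace products"
  by (simp add: products_def)

lemma mul_in_products [simp]: "x \<cdot> y \<in> products"
  unfolding products_def by (rule fl.span_base) auto

lemma ract_in_products [simp]: "ract k x \<in> products"
  unfolding ract_def by (rule fl.subspace_neg[OF subspace_products]) simp

lemma ractl_in_products [simp]: "x \<in> products \<Longrightarrow> ractl ks x \<in> products"
  by (induction ks arbitrary: x) simp_all

definition wedge :: "nat \<Rightarrow> nat \<Rightarrow> nat list \<Rightarrow> 'k::field free_leibniz" where
  "wedge i j ks =
     (if ks = [] then fl_scale (1 / 2) (gen i \<cdot> gen j - gen j \<cdot> gen i) else ractl ks (gen i \<cdot> gen j))"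

text \<open>In characteristic 2, \<open>wedge i j []\<close> is the junk value \<open>0\<close>.\<close>

definition wedges :: "'k::field free_leibniz set" where
  "wedges = {wedge i j ks | i j ks. ks \<noteq> [] \<or> CHAR('k) \<noteq> 2}"

lemma wedge_in_products [simp]: "wedge i j ks \<in> products"
  by (auto simp: wedge_def intro!: fl.subspace_scale fl.subspace_diff subspace_products)


section \<open>Reduction modulo the generators\<close>

text \<open>These properties are shared by the T-ideals built from \<open>S1\<close> outside
  characteristic 2 and from \<open>S2\<close> in characteristic 2, so the reduction is carried out
  once. \<open>alternating\<close> is listed separately because in characteristic 2 it cannot be
  obtained from \<open>antisymmetric\<close> by halving. The last condition makes every substitution
  into \<open>L3\<close> kill \<open>I\<close>.\<close>

locale L3_ideal =
  fixes I :: "'k::field free_leibniz set"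
  assumes ideal: "fl.ideal I"
    and metabelian: "(x \<cdot> y) \<cdot> (z \<cdot> w) \<in> I"
    and antisymmetric: "x \<cdot> y \<cdot> z + y \<cdot> x \<cdot> z \<in> I"
    and alternating: "x \<cdot> x \<cdot> y \<in> I"
    and jacobi: "z \<cdot> x \<cdot> y - z \<cdot> y \<cdot> x - y \<cdot> x \<cdot> z \<in> I"
    and commutative: "CHAR('k) = 2 \<Longrightarrow> x \<cdot> y - y \<cdot> x \<in> I"
    and identities: "I \<subseteq> identities (*s) (L3_mul :: 'k ^ 3 \<Rightarrow> 'k ^ 3 \<Rightarrow> 'k ^ 3)"
begin

lemma subspace: "fl.subspace I"
  using ideal by (simp add: fl.ideal_def)

lemmas I_add = fl.subspace_add[OF subspace]
  and I_diff = fl.subspace_diff[OF subspace]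
  and I_minus = fl.subspace_neg[OF subspace]
  and I_scale = fl.subspace_scale[OF subspace]
  and I_sum = fl.subspace_sum[OF subspace]
  and I_zero [simp] = fl.subspace_0[OF subspace]

lemma I_mul: "x \<in> I \<Longrightarrow> x \<cdot> y \<in> I" "x \<in> I \<Longrightarrow> y \<cdot> x \<in> I"
  using ideal by (auto simp: fl.ideal_def)

lemma I_ract: "x \<in> I \<Longrightarrow> ract k x \<in> I"
  by (simp add: ract_def I_minus I_mul)

lemma I_ractl: "x \<in> I \<Longrightarrow> ractl ks x \<in> I"
  by (induction ks arbitrary: x) (simp_all add: I_ract)

section \<open>Congruence modulo the ideal\<close>

definition cong :: "'k free_leibniz \<Rightarrow> 'k free_leibniz \<Rightarrow> bool" (infix "\<doteq>" 50) where
  "x \<doteq> y \<longleftrightarrow> x - y \<in> I"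

lemma cong_refl [simp]: "x \<doteq> x"
  by (simp add: cong_def)

lemma cong_sym: "x \<doteq> y \<Longrightarrow> y \<doteq> x"
  using I_minus by (force simp: cong_def)

lemma cong_trans [trans]: "x \<doteq> y \<Longrightarrow> y \<doteq> z \<Longrightarrow> x \<doteq> z"
  using I_add by (force simp: cong_def)

lemma cong_diff: "x \<doteq> x' \<Longrightarrow> y \<doteq> y' \<Longrightarrow> x - y \<doteq> x' - y'"
  using I_diff by (force simp: cong_def algebra_simps)

lemma cong_scale: "x \<doteq> x' \<Longrightarrow> fl_scale c x \<doteq> fl_scale c x'"
  using I_scale by (force simp: cong_def simp flip: fl.scale_right_diff_distrib)

lemma cong_ractl: "x \<doteq> x' \<Longrightarrow> ractl ks x \<doteq> ractl ks x'"
  using I_ractl by (force simp: cong_def simp flip: ractl_diff)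

lemma cong_ract: "x \<doteq> x' \<Longrightarrow> ract k x \<doteq> ract k x'"
  using cong_ractl[of x x' "[k]"] by simp

lemma cong_in_I: "x \<doteq> y \<Longrightarrow> y \<in> I \<Longrightarrow> x \<in> I"
  using I_add by (force simp: cong_def)

lemma cong_span:
  assumes "x \<doteq> y" "y \<in> fl.span (X \<union> I)" shows "x \<in> fl.span (X \<union> I)"
proof -
  have "x = y + (x - y)" by simp
  then show ?thesis using assms by (metis Un_iff cong_def fl.span_add fl.span_base)
qed

lemma products_mul:
  assumes "u \<in> products" "w \<in> products"
  shows "u \<cdot> w \<in> I"
proof -
  have "(x \<cdot> y) \<cdot> w \<in> I" for x y
    using assms(2) unfolding products_def
    by (induction rule: fl.span_induct)
      (auto simp: fl.subspace_def fl.mul_add_right fl.mul_scale_right I_add I_scale metabelian)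
  from assms(1) this show ?thesis unfolding products_def
    by (induction rule: fl.span_induct)
      (auto simp: fl.subspace_def fl.mul_add_left fl.mul_scale_left I_add I_scale)
qed

text \<open>By the Leibniz rule the difference is \<open>u \<cdot> (gen k \<cdot> gen j)\<close>, a
  product of two elements of the square.\<close>

lemma ract_commute:
  assumes "u \<in> products" shows "ract j (ract k u) \<doteq> ract k (ract j u)"
proof -
  have "u \<cdot> (gen k \<cdot> gen j) \<in> I" using assms by (simp add: products_mul)
  then show ?thesis by (simp add: cong_def ract_def fl.leibniz fl.mul_diff_left[of 0, simplified])
qed

lemma ractl_ract:
  assumes "u \<in> products" shows "ractl ks (ract k u) \<doteq> ract k (ractl ks u)"
  using assms
proof (induction ks arbitrary: u)
  case (Cons j ks)
  have "ractl (j # ks) (ract k u) \<doteq> ractl ks (ract k (ract j u))"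
    by (simp add: cong_ractl ract_commute Cons.prems)
  also have "\<dots> \<doteq> ract k (ractl (j # ks) u)" by (simp add: Cons.IH)
  finally show ?case .
qed simp

text \<open>The first letter of \<open>ks\<close> is carried past the letters before its occurrence
  in \<open>ms\<close>; induction handles the rest.\<close>

lemma ractl_perm:
  assumes "u \<in> products" "mset ks = mset ms" shows "ractl ks u \<doteq> ractl ms u"
  using assms
proof (induction ks arbitrary: ms u)
  case (Cons k ks)
  then have "k \<in> set ms" by (metis list.set_intros(1) set_mset_mset)
  then obtain ms1 ms2 where ms: "ms = ms1 @ k # ms2" by (meson split_list)
  with Cons.prems have "mset ks = mset (ms1 @ ms2)" by simp
  then have "ractl (k # ks) u \<doteq> ractl (ms1 @ ms2) (ract k u)"
    using Cons.IH[of "ract k u" "ms1 @ ms2"] by simp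
  also have "\<dots> = ractl ms2 (ractl ms1 (ract k u))" by simp
  also have "\<dots> \<doteq> ractl ms2 (ract k (ractl ms1 u))"
    by (intro cong_ractl ractl_ract Cons.prems)
  also have "\<dots> = ractl ms u" by (simp add: ms)
  finally show ?case .
qed simp

text \<open>Only the empty word needs an argument: there the two sides differ by half an instance of
  \<open>antisymmetric\<close>.\<close>

lemma ract_wedge:
  assumes "ks \<noteq> [] \<or> CHAR('k) \<noteq> 2"
  shows "ract k (wedge i j ks) \<doteq> wedge i j (ks @ [k])"
proof (cases "ks = []")
  case True
  with assms have "(2::'k) \<noteq> 0" by (simp add: two_neq_0_iff)
  have half: "fl_scale (1 / 2) x + fl_scale (1 / 2) x = x" for x :: "'k free_leibniz"
    using \<open>(2::'k) \<noteq> 0\<close> by (simp flip: fl.scale_left_distrib)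
  let ?x = "gen i \<cdot> gen j \<cdot> gen k :: 'k free_leibniz" and ?y = "gen j \<cdot> gen i \<cdot> gen k :: 'k free_leibniz"
  have "ract k (wedge i j ks) - wedge i j (ks @ [k]) = fl_scale (1 / 2) (?y - ?x) + ?x"
    using True by (simp add: wedge_def ract_scale ract_diff) (simp add: ract_def)
  also have "\<dots> = fl_scale (1 / 2) (?y - ?x) + (fl_scale (1 / 2) ?x + fl_scale (1 / 2) ?x)"
    by (simp only: half)
  also have "\<dots> = fl_scale (1 / 2) (?x + ?y)"
    by (simp add: fl.scale_right_distrib fl.scale_right_diff_distrib)
  finally show ?thesis by (simp add: cong_def I_scale antisymmetric)
qed (simp add: wedge_def)

lemma wedge_perm: "mset ks = mset ms \<Longrightarrow> wedge i j ks \<doteq> wedge i j ms"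
  by (cases "ks = []") (auto simp: wedge_def intro!: ractl_perm)

text \<open>Exact for the empty word; otherwise the first letter provides the third factor that
  \<open>antisymmetric\<close> requires.\<close>

lemma wedge_swap: "wedge i j ks \<doteq> - wedge j i ks"
proof (cases ks)
  case Nil
  then show ?thesis by (simp add: wedge_def flip: fl.scale_minus_right)
next
  case (Cons k ms)
  have "wedge i j ks - - wedge j i ks = ractl ms (- (gen i \<cdot> gen j \<cdot> gen k + gen j \<cdot> gen i \<cdot> gen k))"
    by (simp add: Cons wedge_def ract_def flip: ractl_add)
  also have "\<dots> \<in> I" by (intro I_ractl I_minus antisymmetric)
  finally show ?thesis by (simp only: cong_def)
qed

lemma wedge_self: "wedge i i ks \<in> I"
  by (cases ks) (auto simp: wedge_def ract_def intro!: I_ractl I_minus alternating)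

text \<open>The difference is \<open>jacobi\<close> on \<open>gen k\<close>, \<open>gen j\<close>,
  \<open>gen i\<close>, carried along by the letters of \<open>ks\<close>. It serves to bring a
  chosen index to the front.\<close>

lemma wedge_jacobi: "wedge i j (k # ks) \<doteq> wedge k j (i # ks) - wedge k i (j # ks)"
proof -
  have "wedge i j (k # ks) - (wedge k j (i # ks) - wedge k i (j # ks)) =
      ractl ks (gen k \<cdot> gen j \<cdot> gen i - gen k \<cdot> gen i \<cdot> gen j - gen i \<cdot> gen j \<cdot> gen k)"
    by (simp add: wedge_def ract_def flip: ractl_diff) (simp add: algebra_simps)
  also have "\<dots> \<in> I" by (intro I_ractl jacobi)
  finally show ?thesis by (simp only: cong_def)
qed

section \<open>A spanning set modulo the ideal\<close>

definition leading :: "'k free_leibniz set" where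
  "leading = range gen \<union> {gen i \<cdot> gen j | i j. i \<le> j}"

text \<open>For \<open>i > j\<close> the reversed product is leading, and the commutator is twice a
  wedge or, in characteristic 2, an element of \<open>I\<close>.\<close>

lemma mul_gen_in_span: "gen i \<cdot> gen j \<in> fl.span (leading \<union> (wedges \<union> I))" (is "_ \<in> fl.span ?U")
proof (cases "i \<le> j")
  case True
  then show ?thesis by (intro fl.span_base) (auto simp: leading_def)
next
  case False
  have "gen i \<cdot> gen j - gen j \<cdot> gen i \<in> fl.span ?U"
  proof (cases "CHAR('k) = 2")
    case True
    then show ?thesis by (intro fl.span_base) (auto simp: commutative)
  next
    case False
    then have "(2::'k) \<noteq> 0" by (simp add: two_neq_0_iff)
    then have "gen i \<cdot> gen j - gen j \<cdot> gen i = fl_scale (2::'k) (wedge i j [])"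
      by (simp add: wedge_def)
    also have "\<dots> \<in> fl.span ?U"
      using False by (intro fl.span_scale fl.span_base) (auto simp: wedges_def)
    finally show ?thesis .
  qed
  moreover have "gen j \<cdot> gen i \<in> fl.span ?U"
  proof (rule fl.span_base)
    have "j \<le> i" using False by simp
    then show "gen j \<cdot> gen i \<in> leading \<union> (wedges \<union> I)" unfolding leading_def by blast
  qed
  ultimately show ?thesis using fl.span_add by fastforce
qed

text \<open>The span \<open>?W\<close> of the generators, the words \<open>?T\<close> and
  \<open>I\<close> is closed under multiplication, so it is the whole free algebra. Separating the
  words with empty tail from the others then gives the stated spanning set.\<close>

lemma all_in_span: "f \<in> fl.span (leading \<union> (wedges \<union> I))"
proof -
  let ?T = "{ractl ks (gen i \<cdot> gen j) | ks i j. True}"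
  let ?G = "range gen \<union> ?T \<union> I"
  let ?W = "fl.span ?G"
  have base: "x \<in> ?W" if "x \<in> ?G" for x using that by (rule fl.span_base)
  have T_prod: "x \<in> products" if "x \<in> ?T" for x using that by auto
  have right_gen: "x \<cdot> gen k \<in> ?W" if "x \<in> ?W" for x k
    using that
  proof (induction rule: fl.span_induct)
    case base
    show ?case by (auto simp: fl.subspace_def fl.mul_add_left fl.mul_scale_left fl.span_add fl.span_scale fl.span_zero)
  next
    case (step x)
    then consider i where "x = gen i" | ks i j where "x = ractl ks (gen i \<cdot> gen j)" | "x \<in> I"
      by auto
    then show ?case
    proof cases
      case 1
      then have "x \<cdot> gen k = ractl [] (gen i \<cdot> gen k)" by simp
      then show ?thesis by (intro base) blast
    next
      case 2
      then have "x \<cdot> gen k = - ractl (ks @ [k]) (gen i \<cdot> gen j)" by (simp add: ract_def)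
      moreover have "ractl (ks @ [k]) (gen i \<cdot> gen j) \<in> ?W" by (intro base) blast
      ultimately show ?thesis by (simp only: fl.span_neg)
    next
      case 3
      then show ?thesis by (intro base) (simp add: I_mul)
    qed
  qed
  \<comment> \<open>The Leibniz rule moves the last letter out; in one of the two terms
    \<open>gen k \<cdot> gen l\<close> then meets an element of the square, so that term lies in
    \<open>I\<close>.\<close>
  have left_gen: "gen k \<cdot> ractl ks (gen i \<cdot> gen j) \<in> ?W" for k ks i j
  proof (induction ks rule: rev_induct)
    case Nil
    have "gen k \<cdot> gen i \<cdot> gen j \<in> ?W" for i j by (intro right_gen base) blast
    then show ?case by (simp add: fl.leibniz fl.span_diff)
  next
    case (snoc l ks)
    let ?z = "ractl ks (gen i \<cdot> gen j) :: 'k free_leibniz"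
    have 1: "gen k \<cdot> gen l \<cdot> ?z \<in> ?W" by (intro base) (simp add: products_mul)
    have 2: "gen k \<cdot> ?z \<cdot> gen l \<in> ?W" using snoc by (rule right_gen)
    have "gen k \<cdot> ractl (ks @ [l]) (gen i \<cdot> gen j) = gen k \<cdot> gen l \<cdot> ?z - gen k \<cdot> ?z \<cdot> gen l"
      using fl.mul_diff_right[of "gen k" 0 "?z \<cdot> gen l"] by (simp add: ract_def fl.leibniz)
    then show ?case using fl.span_diff[OF 1 2] by simp
  qed
  have mul_base: "x \<cdot> y \<in> ?W" if "x \<in> ?G" "y \<in> ?G" for x y
  proof -
    consider "x \<in> I \<or> y \<in> I" | "x \<in> ?T" "y \<in> ?T" | i where "y = gen i" | i where "x = gen i" "y \<in> ?T"
      using \<open>x \<in> ?G\<close> \<open>y \<in> ?G\<close> by blast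
    then show ?thesis
    proof cases
      case 1
      then show ?thesis by (intro base) (auto simp: I_mul)
    next
      case 2
      then have "x \<cdot> y \<in> I" using T_prod products_mul by blast
      then show ?thesis by (intro base) blast
    next
      case 3
      then show ?thesis using right_gen base[OF \<open>x \<in> ?G\<close>] by blast
    next
      case 4
      then show ?thesis using left_gen by blast
    qed
  qed
  have mul_span: "x \<cdot> y \<in> ?W" if "x \<in> ?W" "y \<in> ?W" for x y
  proof -
    have "g \<cdot> y \<in> ?W" if "g \<in> ?G" for g
      using \<open>y \<in> ?W\<close>
    proof (induction rule: fl.span_induct)
      case base
      show ?case
        by (auto simp: fl.subspace_def fl.mul_add_right fl.mul_scale_right fl.span_add fl.span_scale fl.span_zero)
    next
      case (step y)
      with that show ?case by (rule mul_base)
    qed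
    with \<open>x \<in> ?W\<close> show ?thesis
      by (induction rule: fl.span_induct)
        (auto simp: fl.subspace_def fl.mul_add_left fl.mul_scale_left fl.span_add fl.span_scale fl.span_zero)
  qed
  have "f \<in> ?W"
  proof (induction f rule: free_leibniz_induct)
    case (gen n)
    show ?case by (intro base) blast
  next
    case (mul x y)
    then show ?case by (rule mul_span)
  qed (simp_all only: fl.span_add fl.span_scale fl.span_zero)
  moreover have "?W \<subseteq> fl.span (leading \<union> (wedges \<union> I))"
  proof (rule fl.span_minimal)
    show "?G \<subseteq> fl.span (leading \<union> (wedges \<union> I))"
    proof
      fix x assume "x \<in> ?G"
      then consider "x \<in> range gen \<union> I" | i j where "x = gen i \<cdot> gen j"
        | ks i j where "x = ractl ks (gen i \<cdot> gen j)" "ks \<noteq> []"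
        by (auto; metis fold_simps(1))
      then show "x \<in> fl.span (leading \<union> (wedges \<union> I))"
      proof cases
        case 1
        then show ?thesis by (intro fl.span_base) (auto simp: leading_def)
      next
        case 2
        then show ?thesis using mul_gen_in_span by simp
      next
        case 3
        then have "x = wedge i j ks" by (simp add: wedge_def)
        with 3 have "x \<in> wedges" unfolding wedges_def by blast
        then show ?thesis by (intro fl.span_base) simp
      qed
    qed
  qed simp
  ultimately show ?thesis by blast
qed

end


section \<open>Substitutions into \<open>L\<^sub>3\<close>\<close>

abbreviation L3_hom :: "('k::field free_leibniz \<Rightarrow> 'k ^ 3) \<Rightarrow> bool" where
  "L3_hom \<equiv> algebra_hom fl_scale fl_mul (*s) L3_mul"

lemma identitiesD: "f \<in> identities (*s) L3_mul \<Longrightarrow> L3_hom \<phi> \<Longrightarrow> \<phi> f = 0"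
  by (simp add: identities_def)

lemma ex_L3_hom:
  obtains \<phi> where "L3_hom \<phi>" "\<And>n. \<phi> (gen n) $ 1 = c n" "\<And>n. \<phi> (gen n) $ 2 = a n"
    "\<And>n. \<phi> (gen n) $ 3 = (b n :: 'k::field)"
proof -
  obtain \<phi> where "L3_hom \<phi>" "\<forall>n. \<phi> (gen n) = vector [c n, a n, b n]"
    using free_leibniz_universal[OF L3.leibniz_algebra_axioms, of "\<lambda>n. vector [c n, a n, b n]"]
    by blast
  with that[of \<phi>] show thesis by simp
qed

context
  fixes \<phi> :: "'k::field free_leibniz \<Rightarrow> 'k ^ 3"
  assumes hom: "L3_hom \<phi>"
begin

lemma hom_mult: "\<phi> (x \<cdot> y) = L3_mul (\<phi> x) (\<phi> y)"
  using hom by (simp add: algebra_hom_def)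

lemma module_hom_L3: "module_hom fl_scale (*s) \<phi>"
  using hom by (simp add: algebra_hom_def module_hom_iff_linear)

lemmas hom_linear = module_hom_L3[THEN module_hom.add] module_hom_L3[THEN module_hom.scale]
  module_hom_L3[THEN module_hom.zero] module_hom_L3[THEN module_hom.neg]
  module_hom_L3[THEN module_hom.diff] module_hom_L3[THEN module_hom.sum]

lemma hom_products: "u \<in> products \<Longrightarrow> \<phi> u $ 3 = 0"
  unfolding products_def
  by (induction rule: fl.span_induct) (auto simp: fl.subspace_def hom_linear hom_mult L3_mul_nth)

text \<open>Right multiplication by an element with third coordinate b annihilates e_1 and sends e_2
  to -b e_2; the sign of \<open>ract\<close> removes the minus.\<close>

lemma hom_ract:
  assumes "\<phi> u $ 3 = 0"
  shows "\<phi> (ract k u) $ 1 = 0" "\<phi> (ract k u) $ 2 = \<phi> u $ 2 * \<phi> (gen k) $ 3"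
    "\<phi> (ract k u) $ 3 = 0"
  using assms by (simp_all add: ract_def hom_linear hom_mult L3_mul_nth)

lemma hom_ractl:
  assumes "\<phi> u $ 3 = 0"
  shows "\<phi> (ractl ks u) $ 2 = \<phi> u $ 2 * monom_val ks (\<lambda>n. \<phi> (gen n) $ 3)"
    and "\<phi> (ractl ks u) $ 1 = (if ks = [] then \<phi> u $ 1 else 0)"
  using assms by (induction ks arbitrary: u) (simp_all add: hom_ract)

lemma hom_wedge:
  assumes "ks \<noteq> [] \<or> CHAR('k) \<noteq> 2"
  shows "\<phi> (wedge i j ks) $ 2 = (\<phi> (gen i) $ 3 * \<phi> (gen j) $ 2 - \<phi> (gen i) $ 2 * \<phi> (gen j) $ 3)
      * monom_val ks (\<lambda>n. \<phi> (gen n) $ 3)"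
proof (cases "ks = []")
  case True
  with assms have "(2::'k) \<noteq> 0" by (simp add: two_neq_0_iff)
  define D where "D = \<phi> (gen i) $ 3 * \<phi> (gen j) $ 2 - \<phi> (gen i) $ 2 * \<phi> (gen j) $ 3"
  \<comment> \<open>Antisymmetrizing doubles the determinant \<open>D\<close>, and the factor 1/2
    restores it.\<close>
  have "\<phi> (wedge i j ks) $ 2 = 1 / 2 * (2 * D)"
    using True by (simp add: wedge_def hom_linear hom_mult L3_mul_nth D_def algebra_simps)
  also have "\<dots> = D" using \<open>(2::'k) \<noteq> 0\<close> by simp
  finally show ?thesis using True by (simp add: D_def)
next
  case False
  then show ?thesis
    by (simp add: wedge_def hom_ractl hom_products) (simp add: hom_mult L3_mul_nth)
qed

text \<open>For the empty word the e_1-coordinates b_i b_j and b_j b_i cancel; otherwise one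
  application of \<open>ract\<close> already removes this coordinate.\<close>

lemma hom_wedge_1: "\<phi> (wedge i j ks) $ 1 = 0"
  by (simp add: wedge_def hom_ractl hom_products) (simp add: hom_linear hom_mult L3_mul_nth)

end

context L3_ideal
begin

lemma hom_I: "L3_hom \<phi> \<Longrightarrow> x \<in> I \<Longrightarrow> \<phi> x = 0"
  using identities identitiesD by blast

text \<open>The e_1-coordinate does not see the wedge part, so it becomes a relation between the
  linear and the quadratic coefficients. Substitutions with values 0 and 1 already make these
  vanish, whatever the field.\<close>

lemma identity_in_span_wedges:
  assumes f: "f \<in> identities (*s) (L3_mul :: 'k ^ 3 \<Rightarrow> 'k ^ 3 \<Rightarrow> 'k ^ 3)"
  shows "f \<in> fl.span (wedges \<union> I)"
proof -
  let ?m = "\<lambda>p. gen (fst p) \<cdot> gen (snd p) :: 'k free_leibniz"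
  have lead: "leading = range gen \<union> ?m ` {p. fst p \<le> snd p}"
    
  proof -
    have "{gen i \<cdot> gen j | i j. i \<le> j} = ?m ` {p. fst p \<le> snd p}"
      by (auto simp: image_def)
    then show ?thesis by (simp only: leading_def)
  qed
  have "f \<in> fl.span (range gen \<union> (?m ` {p. fst p \<le> snd p} \<union> (wedges \<union> I)))"
    using all_in_span[of f] unfolding lead by (simp only: Un_assoc)
  then obtain g1 r where f_split: "f = g1 + r" and g1_span: "g1 \<in> fl.span (range gen)"
    and "r \<in> fl.span (?m ` {p. fst p \<le> snd p} \<union> (wedges \<union> I))"
    unfolding fl.span_Un[of "range gen"] by blast
  then obtain g2 h where r_split: "r = g2 + h" and g2_span: "g2 \<in> fl.span (?m ` {p. fst p \<le> snd p})"
    and h: "h \<in> fl.span (wedges \<union> I)"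
    unfolding fl.span_Un[of "?m ` _"] by blast
  have fgh: "f = g1 + g2 + h" by (simp add: f_split r_split)
  obtain A l where A: "finite A" and g1: "g1 = (\<Sum>i\<in>A. fl_scale (l i) (gen i))"
    using fl.span_image_sum[OF g1_span] by blast
  obtain B d where fin_B: "finite B" and B: "B \<subseteq> {p. fst p \<le> snd p}"
    and g2: "g2 = (\<Sum>p\<in>B. fl_scale (d p) (?m p))"
    using fl.span_image_sum[OF g2_span] by blast
  note fin = A fin_B and g = g1 g2
  have eq: "(\<Sum>i\<in>A. l i * c i) + (\<Sum>p\<in>B. d p * (b (fst p) * b (snd p))) = 0" for c b :: "nat \<Rightarrow> 'k"
  proof -
    obtain \<phi> where \<phi>: "L3_hom \<phi>" "\<And>n. \<phi> (gen n) $ 1 = c n" "\<And>n. \<phi> (gen n) $ 2 = 0"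
      "\<And>n. \<phi> (gen n) $ 3 = b n"
      using ex_L3_hom[of c "\<lambda>_. 0" b] by blast
    note lin = hom_linear[OF \<phi>(1)]
    have "\<phi> h $ 1 = 0" using h
      by (induction rule: fl.span_induct)
        (auto simp: fl.subspace_def lin wedges_def hom_wedge_1[OF \<phi>(1)] hom_I[OF \<phi>(1)])
    moreover have "\<phi> f = 0" using f \<phi>(1) by (rule identitiesD)
    ultimately have "\<phi> f $ 1 = 0" "\<phi> h $ 1 = 0" by simp_all
    then have "\<phi> g1 $ 1 + \<phi> g2 $ 1 = 0"
      by (simp add: fgh lin)
    then show ?thesis
      by (simp add: g lin \<phi>(2,4) hom_mult[OF \<phi>(1)] L3_mul_nth)
  qed
  have "l i = 0" if "i \<in> A" for i
  proof -
    have "(\<Sum>j\<in>A. l j * (if j = i then 1 else 0)) = (\<Sum>j\<in>A. if j = i then l j else 0)"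
      by (intro sum.cong) auto
    with eq[of "\<lambda>n. if n = i then 1 else 0" "\<lambda>_. 0"] fin that show ?thesis by simp
  qed
  then have "g1 = 0" by (simp add: g)
  have diag: "d (i, i) = 0" if "(i, i) \<in> B" for i
  proof -
    have "(\<Sum>p\<in>B. d p * ((if fst p = i then 1 else 0) * (if snd p = i then 1 else 0))) =
        (\<Sum>p\<in>B. if p = (i, i) then d p else 0)"
      by (intro sum.cong) (auto simp: prod_eq_iff)
    with eq[of "\<lambda>_. 0" "\<lambda>n. if n = i then 1 else 0"] fin that show ?thesis by simp
  qed
  have "d p = 0" if "p \<in> B" for p
  proof (cases p)
    case (Pair i j)
    \<comment> \<open>For distinct \<open>i\<close> and \<open>j\<close> this indicator keeps the
      pairs (i, i), (j, j) and (i, j): the diagonal coefficients are already 0, and the ordering in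
      \<open>B\<close> excludes (j, i).\<close>
    let ?b = "\<lambda>n. if n = i \<or> n = j then 1 else 0 :: 'k"
    have "(\<Sum>r\<in>B. d r * (?b (fst r) * ?b (snd r))) = (\<Sum>r\<in>B. if r = p then d r else 0)"
    proof (intro sum.cong refl)
      fix r assume "r \<in> B"
      then have "fst r = snd r \<Longrightarrow> d r = 0" using diag by (metis prod.collapse)
      moreover have "fst r \<le> snd r" "fst p \<le> snd p" using B that \<open>r \<in> B\<close> by auto
      ultimately show "d r * (?b (fst r) * ?b (snd r)) = (if r = p then d r else 0)"
        using Pair by (cases "fst r = snd r") (auto simp: prod_eq_iff)
    qed
    with eq[of "\<lambda>_. 0" ?b] fin that show ?thesis by simp
  qed
  then have "g2 = 0" by (simp add: g)
  with \<open>g1 = 0\<close> fgh h show ?thesis by simp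
qed


section \<open>Infinite fields\<close>

text \<open>A monomial of multidegree \<open>N\<close> is a combination of those whose first variable is any fixed
  element of \<open>N\<close>; the minimum is an arbitrary choice.\<close>

definition normal :: "nat multiset \<times> nat \<Rightarrow> 'k free_leibniz" where
  "normal p = (case p of (N, l) \<Rightarrow>
     wedge (Min_mset N) l (sorted_list_of_multiset (N - {#Min_mset N, l#})))"

text \<open>A second index equal to the minimum is left out because such wedges lie in
  \<open>I\<close>. The size condition repeats the one in \<open>wedges\<close>: in characteristic 2
  a letter must remain after the two leading indices.\<close>

definition normal_index :: "(nat multiset \<times> nat) set" where
  "normal_index = {(N, l). l \<in># N \<and> l \<noteq> Min_mset N \<and> (size N > 2 \<or> CHAR('k) \<noteq> 2)}"

lemma wedge_in_span_normal:
  assumes "ks \<noteq> [] \<or> CHAR('k) \<noteq> 2"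
  shows "wedge i j ks \<in> fl.span (normal ` normal_index \<union> I)" (is "_ \<in> ?W")
proof -
  define N where "N = {#i, j#} + mset ks"
  define k where "k = Min_mset N"
  have "k \<in># N" unfolding k_def by (rule Min_in) (auto simp: N_def)
  \<comment> \<open>Once the minimum stands in front, sorting the tail gives the normal element
    itself, unless both indices agree and the wedge lies in \<open>I\<close>.\<close>
  have wedge_k: "wedge k l ms \<in> ?W" if N: "N = {#k, l#} + mset ms" for l ms
  proof (cases "l = k")
    case True
    then show ?thesis by (intro fl.span_base) (auto simp: wedge_self)
  next
    case False
    have "length ms = length ks"
      using arg_cong[OF N, of size] by (simp add: N_def)
    then have "size N > 2 \<or> CHAR('k) \<noteq> 2" using assms by (cases ks) (simp_all add: N)
    moreover have "l \<in># N" unfolding N by simp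
    ultimately have "(N, l) \<in> normal_index"
      using False unfolding k_def by (simp add: normal_index_def)
    then have "normal (N, l) \<in> ?W" by (intro fl.span_base) blast
    moreover have "mset ms = N - {#k, l#}" by (simp add: N)
    then have "wedge k l ms \<doteq> normal (N, l)"
      by (simp add: normal_def wedge_perm flip: k_def)
    ultimately show ?thesis by (rule cong_span[rotated])
  qed
  show ?thesis
  proof (cases "k = i \<or> k = j")
    case True
    then show ?thesis
    proof
      assume "k = i"
      have "N = {#k, j#} + mset ks" unfolding N_def \<open>k = i\<close> by simp
      then show ?thesis unfolding \<open>k = i\<close>[symmetric] by (rule wedge_k)
    next
      assume "k = j"
      have "N = {#k, i#} + mset ks" unfolding N_def \<open>k = j\<close> by (simp add: add_mset_commute)
      then have "wedge j i ks \<in> ?W" unfolding \<open>k = j\<close>[symmetric] by (rule wedge_k)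
      then show ?thesis by (rule cong_span[OF wedge_swap fl.span_neg])
    qed
  next
    case False
    with \<open>k \<in># N\<close> have "k \<in> set ks" by (simp add: N_def)
    then obtain ms1 ms2 where "ks = ms1 @ k # ms2" by (meson split_list)
    then obtain ms where ks: "mset ks = mset (k # ms)" using that[of "ms1 @ ms2"] by simp
    \<comment> \<open>The minimum occurs only in the tail; the Jacobi relation exchanges it with a
      leading index in each of the two terms.\<close>
    have "wedge i j ks \<doteq> wedge i j (k # ms)" by (rule wedge_perm) (rule ks)
    also have "\<dots> \<doteq> wedge k j (i # ms) - wedge k i (j # ms)" by (rule wedge_jacobi)
    finally have cong: "wedge i j ks \<doteq> wedge k j (i # ms) - wedge k i (j # ms)" .
    have "N = {#k, j#} + mset (i # ms)" "N = {#k, i#} + mset (j # ms)"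
      unfolding N_def ks by simp_all
    then show ?thesis by (intro cong_span[OF cong fl.span_diff] wedge_k)
  qed
qed

text \<open>Each coefficient is isolated by a substitution whose second coordinates vanish except at
  \<open>l\<close>, the third coordinates staying free. Every normal element then takes 0 or a
  signed monomial as its e_2-coordinate, and no other index shares the monomial of
  \<open>p\<close>.\<close>

lemma infinite_identity_in_I:
  assumes inf: "infinite (UNIV :: 'k set)"
    and f: "f \<in> identities (*s) (L3_mul :: 'k ^ 3 \<Rightarrow> 'k ^ 3 \<Rightarrow> 'k ^ 3)"
  shows "f \<in> I"
proof -
  have "wedges \<union> I \<subseteq> fl.span (normal ` normal_index \<union> I)"
    by (auto simp: wedges_def intro: wedge_in_span_normal fl.span_base)
  then have "f \<in> fl.span (normal ` normal_index \<union> I)"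
    using identity_in_span_wedges[OF f] by (meson fl.span_minimal fl.subspace_span subsetD)
  then obtain g where "g \<in> fl.span (normal ` normal_index)" and fg: "f - g \<in> I"
    using fl.subspace_span_Un[OF subspace] by blast
  then obtain A d where A: "finite A" "A \<subseteq> normal_index" and g: "g = (\<Sum>p\<in>A. fl_scale (d p) (normal p))"
    using fl.span_image_sum by blast
  have "d p = 0" if "p \<in> A" for p
  proof -
    define l where "l = snd p"
    \<comment> \<open>The three values tell whether \<open>l\<close> is the second leading index,
      the first, or neither; \<open>m\<close> lists the letters left after removing one
      \<open>l\<close>.\<close>
    define \<sigma> :: "nat multiset \<times> nat \<Rightarrow> 'k" where
      "\<sigma> r = (if snd r = l then 1 else if Min_mset (fst r) = l then -1 else 0)" for r
    define m where "m r = sorted_list_of_multiset (fst r - {#l#})" for r :: "nat multiset \<times> nat"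
    define S where "S = {r \<in> A. \<sigma> r \<noteq> 0}"
    have mset_m: "fst r = add_mset l (mset (m r))" if "r \<in> S" for r
    proof -
      have "r \<in> normal_index" using that A by (auto simp: S_def)
      then have "snd r \<in># fst r" by (auto simp: normal_index_def)
      moreover from this have "Min_mset (fst r) \<in># fst r" by (intro Min_in) auto
      ultimately have "l \<in># fst r" using that by (auto simp: S_def \<sigma>_def split: if_splits)
      then show ?thesis by (simp add: m_def)
    qed
    have "(\<Sum>r\<in>S. (d r * \<sigma> r) * monom_val (m r) b) = 0" for b
    proof -
      obtain \<phi> where \<phi>: "L3_hom \<phi>" "\<And>n. \<phi> (gen n) $ 1 = 0"
        "\<And>n. \<phi> (gen n) $ 2 = (if n = l then 1 else 0)" "\<And>n. \<phi> (gen n) $ 3 = b n"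
        using ex_L3_hom[of "\<lambda>_. 0" "\<lambda>n. if n = l then 1 else 0" b] by blast
      have val: "\<phi> (normal r) $ 2 = \<sigma> r * monom_val (m r) b" if "r \<in> A" for r
      proof (cases r)
        case (Pair N n)
        define k where "k = Min_mset N"
        define ks where "ks = sorted_list_of_multiset (N - {#k, n#})"
        from that A Pair have n: "n \<in># N" "n \<noteq> k" "size N > 2 \<or> CHAR('k) \<noteq> 2"
          by (auto simp: normal_index_def k_def)
        then have "k \<in># N" unfolding k_def by (intro Min_in) auto
        with n have "{#k, n#} \<subseteq># N"
          by (simp add: insert_subset_eq_iff in_diff_count)
        then have N: "N = {#k, n#} + mset ks"
          unfolding ks_def mset_sorted_list_of_multiset
          by (rule subset_mset.add_diff_inverse[symmetric])
        have "size N = 2 + length ks" unfolding N by simp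
        with n(3) have adm: "ks \<noteq> [] \<or> CHAR('k) \<noteq> 2" by auto
        have "normal r = wedge k n ks" by (simp add: Pair normal_def ks_def k_def)
        then have *: "\<phi> (normal r) $ 2 = (b k * (if n = l then 1 else 0) - (if k = l then 1 else 0) * b n)
            * monom_val ks b"
          by (simp only: hom_wedge[OF \<phi>(1) adm] \<phi>(3,4))
        have m: "mset (m r) = N - {#l#}" by (simp add: m_def Pair)
        have m1: "monom_val (m r) b = monom_val (k # ks) b" if "n = l"
          by (rule monom_val_perm) (use that in \<open>simp add: m N\<close>)
        have m2: "monom_val (m r) b = monom_val (n # ks) b" if "k = l"
          by (rule monom_val_perm) (use that in \<open>simp add: m N\<close>)
        have \<sigma>: "\<sigma> r = (if n = l then 1 else if k = l then - 1 else 0)"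
          by (simp add: \<sigma>_def Pair k_def)
        consider "n = l" "k \<noteq> l" | "k = l" "n \<noteq> l" | "k \<noteq> l" "n \<noteq> l" using n(2) by blast
        then show ?thesis
          by cases (simp_all add: * \<sigma> m1 m2)
      qed
      have "\<phi> g = \<phi> f - \<phi> (f - g)" by (simp add: hom_linear[OF \<phi>(1)])
      then have "\<phi> g = 0" using identitiesD[OF f \<phi>(1)] hom_I[OF \<phi>(1) fg] by simp
      then have "(\<Sum>r\<in>A. d r * \<phi> (normal r) $ 2) = 0"
        by (simp add: g hom_linear[OF \<phi>(1)] vec_eq_iff)
      moreover have "(\<Sum>r\<in>A. d r * \<phi> (normal r) $ 2) = (\<Sum>r\<in>A. d r * \<sigma> r * monom_val (m r) b)"
        by (intro sum.cong) (auto simp: val)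
      moreover have "\<dots> = (\<Sum>r\<in>S. d r * \<sigma> r * monom_val (m r) b)"
        by (rule sum.mono_neutral_right) (auto simp: S_def A)
      ultimately show ?thesis by simp
    qed
    moreover have "p \<in> S" using that by (simp add: S_def \<sigma>_def l_def)
    ultimately have sum0: "(\<Sum>r | r \<in> S \<and> (monom_val (m r) :: _ \<Rightarrow> 'k) = monom_val (m p). d r * \<sigma> r) = 0"
      using A(1) by (intro sum_monom_val_group) (auto simp: S_def)
    \<comment> \<open>Equal monomials force equal multisets. A second index other than
      \<open>l\<close> would then need the minimum to be \<open>l\<close>, which is impossible for
      the multiset of a normal index ending in \<open>l\<close>.\<close>
    have "{r. r \<in> S \<and> (monom_val (m r) :: _ \<Rightarrow> 'k) = monom_val (m p)} = {p}"
    proof (intro equalityI subsetI; clarsimp simp: \<open>p \<in> S\<close>)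
      fix N n assume r: "(N, n) \<in> S" "(monom_val (m (N, n)) :: _ \<Rightarrow> 'k) = monom_val (m p)"
      then have "N = fst p"
        using monom_val_eqD[OF r(2)] inf mset_m[OF r(1)] mset_m[OF \<open>p \<in> S\<close>] by simp
      moreover have "Min_mset (fst p) \<noteq> l"
        using that A by (auto simp: normal_index_def l_def)
      ultimately show "(N, n) = p"
        using r(1) by (auto simp: S_def \<sigma>_def l_def prod_eq_iff split: if_splits)
    qed
    with sum0 show ?thesis by (simp add: \<sigma>_def l_def)
  qed
  then have "g = 0" by (simp add: g)
  with fg show ?thesis by simp
qed

end


section \<open>Finite fields\<close>

locale finite_L3_ideal = L3_ideal I for I :: "'k::field free_leibniz set" +
  fixes q :: nat
  assumes finite_field: "finite (UNIV :: 'k set)"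
    and card_field: "q = CARD('k)"
    and commutator: "x \<cdot> y - y \<cdot> x + fl_scale 2 (y \<cdot> x \<cdot> y\<^bsup>(q - 1)\<^esup>)
      + fl_scale 2 (y \<cdot> x\<^bsup>(q)\<^esup>)
      - fl_scale 2 (y \<cdot> x\<^bsup>(q)\<^esup> \<cdot> y\<^bsup>(q - 1)\<^esup>) \<in> I"
    and power: "x \<cdot> y \<cdot> z\<^bsup>(q)\<^esup> - x \<cdot> y \<cdot> z \<in> I"
begin

section \<open>The q-th power relation and reduced exponents\<close>

lemma q_ge_2: "q \<ge> 2"
  unfolding card_field by (rule finite_field_fermat(2)[OF finite_field])

lemma power_q: "(x::'k) ^ q = x"
proof -
  have "x ^ q = x * x ^ (q - 1)" using q_ge_2 by (cases q) auto
  then show ?thesis using finite_field_fermat(1)[OF finite_field, of x] by (simp add: card_field)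
qed

lemma ractl_power_q:
  assumes "u \<in> products" shows "ractl (replicate q k) u \<doteq> ract k u"
  using assms unfolding products_def cong_def
proof (induction rule: fl.span_induct)
  case base
  have "ractl (replicate q k) (x + y) - ract k (x + y) =
      (ractl (replicate q k) x - ract k x) + (ractl (replicate q k) y - ract k y)" for x y :: "'k free_leibniz"
    by (simp only: ractl_add ract_add) simp
  then show ?case
    by (simp add: fl.subspace_def I_add ractl_scale ract_scale I_scale del: fold_replicate
        flip: fl.scale_right_diff_distrib)
next
  case (step u)
  then obtain x y where "u = x \<cdot> y" by blast
  \<comment> \<open>The scalar is (-1)^q, which equals -1 by \<open>power_q\<close>, also in
    characteristic 2.\<close>
  with power[of x y "gen k"] have "fl_scale (- 1) (ractl (replicate q k) u) + ract k u \<in> I"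
    by (simp add: rmul_pow_eq_ractl power_q ract_def del: fold_replicate)
  from I_minus[OF this] show ?case by (simp add: algebra_simps del: fold_replicate)
qed

text \<open>While some letter occurs q times, \<open>ractl_power_q\<close> replaces q copies by one
  and Fermat's identity keeps the function. The word gets shorter because q is at least 2.\<close>

lemma reduced_exponents:
  assumes "u \<in> products"
  obtains ms where "ractl ks u \<doteq> ractl ms u"
    "(monom_val ms :: (nat \<Rightarrow> 'k) \<Rightarrow> 'k) = monom_val ks" "\<And>k. count (mset ms) k < q"
proof -
  have "\<exists>ms. ractl ks u \<doteq> ractl ms u \<and> (monom_val ms :: (nat \<Rightarrow> 'k) \<Rightarrow> 'k) = monom_val ks
      \<and> (\<forall>k. count (mset ms) k < q)"
  proof (induction ks rule: length_induct)
    case (1 ks)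
    show ?case
    proof (cases "\<forall>k. count (mset ks) k < q")
      case False
      then obtain k where "q \<le> count (mset ks) k" by (meson not_le)
      then have sub: "mset (replicate q k) \<subseteq># mset ks"
        by (simp add: count_le_replicate_mset_subset_eq)
      obtain rs where "mset rs = mset ks - mset (replicate q k)" using ex_mset by blast
      with sub have ks: "mset ks = mset (replicate q k @ rs)" by simp
      have red: "ractl ks u \<doteq> ractl (k # rs) u"
      proof -
        have "ractl ks u \<doteq> ractl (replicate q k @ rs) u"
          by (intro ractl_perm assms ks)
        also have "\<dots> = ractl rs (ractl (replicate q k) u)"
          by (simp only: fold_append comp_apply)
        also have "\<dots> \<doteq> ractl (k # rs) u"
          by (simp add: cong_ractl ractl_power_q assms del: fold_replicate)
        finally show ?thesis .
      qed
      have "(monom_val (k # rs) :: (nat \<Rightarrow> 'k) \<Rightarrow> 'k) = monom_val ks"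
      proof
        fix b :: "nat \<Rightarrow> 'k"
        show "monom_val (k # rs) b = monom_val ks b"
          unfolding monom_val_perm[OF ks] by (simp add: power_q)
      qed
      moreover have "length (k # rs) < length ks"
        using arg_cong[OF ks, of size] q_ge_2 by simp
      ultimately show ?thesis using 1 red cong_trans by metis
    next
      case True
      then show ?thesis by (intro exI[of _ ks]) simp
    qed
  qed
  with that show thesis by blast
qed

text \<open>After reduction of the exponents, equal functions force equal multisets of letters, and
  the order of letters is immaterial on the square.\<close>

lemma ractl_eq_of_monom_val_eq:
  assumes "u \<in> products" "(monom_val ks :: (nat \<Rightarrow> 'k) \<Rightarrow> 'k) = monom_val ms"
  shows "ractl ks u \<doteq> ractl ms u"
proof -
  obtain ks' where ks': "ractl ks u \<doteq> ractl ks' u"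
    "(monom_val ks' :: (nat \<Rightarrow> 'k) \<Rightarrow> 'k) = monom_val ks" "\<And>k. count (mset ks') k < q"
    using reduced_exponents[OF assms(1)] by blast
  obtain ms' where ms': "ractl ms u \<doteq> ractl ms' u"
    "(monom_val ms' :: (nat \<Rightarrow> 'k) \<Rightarrow> 'k) = monom_val ms" "\<And>k. count (mset ms') k < q"
    using reduced_exponents[OF assms(1)] by blast
  have "mset ks' = mset ms'"
    by (rule monom_val_eqD) (use assms(2) ks' ms' card_field in auto)
  then have "ractl ks' u \<doteq> ractl ms' u" by (intro ractl_perm assms(1))
  with ks'(1) ms'(1) show ?thesis using cong_trans cong_sym by blast
qed

text \<open>Among words with one and the same function all terms \<open>ractl (m s) u\<close> are
  congruent, and their coefficients sum to zero by Dedekind's lemma.\<close>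

lemma ractl_combination_in_I:
  assumes u: "u \<in> products" and fin: "finite S"
    and zero: "\<And>b :: nat \<Rightarrow> 'k. (\<Sum>s\<in>S. d s * monom_val (m s) b) = 0"
  shows "(\<Sum>s\<in>S. fl_scale (d s) (ractl (m s) u)) \<in> I"
proof -
  let ?X = "\<lambda>s. monom_val (m s) :: (nat \<Rightarrow> 'k) \<Rightarrow> 'k"
  let ?t = "\<lambda>s. fl_scale (d s) (ractl (m s) u)"
  have "(\<Sum>s | s \<in> S \<and> ?X s = f. ?t s) \<in> I" if "f \<in> ?X ` S" for f
  proof -
    from that obtain r where r: "r \<in> S" "f = ?X r" by blast
    let ?S = "{s. s \<in> S \<and> ?X s = ?X r}"
    have "(\<Sum>s\<in>?S. ?t s) = (\<Sum>s\<in>?S. fl_scale (d s) (ractl (m s) u - ractl (m r) u))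
        + fl_scale (\<Sum>s\<in>?S. d s) (ractl (m r) u)"
      by (simp add: fl.scale_right_diff_distrib sum_subtractf fl.scale_sum_left)
    also have "(\<Sum>s\<in>?S. d s) = 0" using sum_monom_val_group[OF fin zero r(1)] .
    finally show ?thesis
      using ractl_eq_of_monom_val_eq[OF u] r(2) by (auto simp: cong_def intro!: I_sum I_scale)
  qed
  then have "(\<Sum>f\<in>?X ` S. \<Sum>s | s \<in> S \<and> ?X s = f. ?t s) \<in> I" by (rule I_sum)
  then show ?thesis using sum.image_gen[OF fin, of ?t ?X] by simp
qed

section \<open>Products of length at least three\<close>

definition long_wedges :: "'k free_leibniz set" where
  "long_wedges = {wedge i j ks | i j ks. ks \<noteq> []}"

lemma long_wedge_in_span: "ks \<noteq> [] \<Longrightarrow> wedge i j ks \<in> fl.span (long_wedges \<union> I)"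
  by (intro fl.span_base) (auto simp: long_wedges_def)

text \<open>Only wedges with empty tail need work: \<open>commutator\<close> rewrites them through
  products of length at least 3.\<close>

lemma span_wedges_le: "fl.span (wedges \<union> I) \<subseteq> fl.span (long_wedges \<union> I)" (is "_ \<subseteq> ?W")
proof (intro fl.span_minimal fl.subspace_span subsetI)
  fix x assume "x \<in> wedges \<union> I"
  then consider "x \<in> I" | i j where "x = wedge i j []" | i j ks where "x = wedge i j ks" "ks \<noteq> []"
    unfolding wedges_def by blast
  then show "x \<in> ?W"
  proof cases
    case 1
    then show ?thesis by (simp add: fl.span_base)
  next
    case 2
    let ?x = "gen i" and ?y = "gen j" and ?w = "gen j \<cdot> gen i :: 'k free_leibniz"
    obtain n where n: "q = Suc (Suc n)" using q_ge_2 by (metis add_2_eq_Suc le_Suc_ex)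
    have long: "ractl ks (gen a \<cdot> gen b) \<in> ?W" if "ks \<noteq> []" for ks a b
      using long_wedge_in_span[OF that, of a b] that by (simp add: wedge_def)
    have rmul: "rmul_pow z (gen a) m = fl_scale ((- 1) ^ m) (ractl (replicate m a) z)"
      for z :: "'k free_leibniz" and a m by (rule rmul_pow_eq_ractl)
    \<comment> \<open>One of the q factors \<open>?x\<close> is already inside \<open>?w\<close>;
      the q - 1 left over form a nonempty word.\<close>
    have first: "?y \<cdot> ?x\<^bsup>(q)\<^esup> = ?w \<cdot> ?x\<^bsup>(q - 1)\<^esup>"
      by (simp only: rmul_pow_def n diff_Suc_1 funpow_Suc_right comp_apply)
    have a: "?w \<cdot> ?y\<^bsup>(q - 1)\<^esup> \<in> ?W" "?w \<cdot> ?x\<^bsup>(q - 1)\<^esup> \<in> ?W"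
      unfolding rmul by (intro fl.span_scale long; simp add: n)+
    have b: "?w \<cdot> ?x\<^bsup>(q - 1)\<^esup> \<cdot> ?y\<^bsup>(q - 1)\<^esup> \<in> ?W"
    proof -
      have "ractl (replicate (q - 1) i @ replicate (q - 1) j) ?w \<in> ?W"
        by (intro long) (simp add: n)
      then show ?thesis unfolding rmul
        by (simp add: ractl_scale fl.span_scale del: fold_replicate)
    qed
    have "gen i \<cdot> gen j - gen j \<cdot> gen i \<in> ?W"
    proof (rule cong_span)
      show "gen i \<cdot> gen j - gen j \<cdot> gen i \<doteq>
        fl_scale 2 (?w \<cdot> ?x\<^bsup>(q - 1)\<^esup> \<cdot> ?y\<^bsup>(q - 1)\<^esup>) - fl_scale 2 (?w \<cdot> ?y\<^bsup>(q - 1)\<^esup>)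
        - fl_scale 2 (?w \<cdot> ?x\<^bsup>(q - 1)\<^esup>)"
        using commutator[of ?x ?y] unfolding first by (simp add: cong_def algebra_simps)
      show "fl_scale 2 (?w \<cdot> ?x\<^bsup>(q - 1)\<^esup> \<cdot> ?y\<^bsup>(q - 1)\<^esup>) - fl_scale 2 (?w \<cdot> ?y\<^bsup>(q - 1)\<^esup>)
        - fl_scale 2 (?w \<cdot> ?x\<^bsup>(q - 1)\<^esup>) \<in> ?W"
        by (intro fl.span_diff fl.span_scale a b)
    qed
    then show ?thesis by (simp add: 2 wedge_def fl.span_scale)
  next
    case 3
    then show ?thesis using long_wedge_in_span by simp
  qed
qed

text \<open>The Jacobi identity moves \<open>x\<^sub>k\<close> to the front; the terms \<open>wedge k l\<close> with \<open>l \<noteq> k\<close> can then be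
  separated by substitutions.\<close>

lemma ract_in_span_wedge:
  assumes "f \<in> fl.span (long_wedges \<union> I)"
  shows "ract k f \<in> fl.span ((\<lambda>p. wedge k (fst p) (snd p)) ` {p. snd p \<noteq> []} \<union> I)" (is "_ \<in> ?W")
  using assms
proof (induction rule: fl.span_induct)
  case base
  show ?case using subspace_ract_vimage[of ?W k] by simp
next
  case (step f)
  have W: "wedge k j ms \<in> ?W" if "ms \<noteq> []" for j ms
    using that by (intro fl.span_base UnI1 image_eqI[of _ _ "(j, ms)"]) auto
  from step show ?case
  proof
    assume "f \<in> long_wedges"
    then obtain i j ks where f: "f = wedge i j ks" "ks \<noteq> []" by (auto simp: long_wedges_def)
    then have "ract k f \<doteq> wedge i j (ks @ [k])" by (simp add: ract_wedge)
    also have "\<dots> \<doteq> wedge i j (k # ks)" by (rule wedge_perm) simp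
    also have "\<dots> \<doteq> wedge k j (i # ks) - wedge k i (j # ks)" by (rule wedge_jacobi)
    finally show ?case by (rule cong_span) (intro fl.span_diff W; simp)
  next
    assume "f \<in> I"
    then show ?case by (simp add: I_ract fl.span_base)
  qed
qed

text \<open>Taking the second coordinates to be the indicator of \<open>l\<close> leaves the terms
  with second index \<open>l\<close>, whose values are the monomials of \<open>k # snd p\<close>.
  The extra \<open>ract k\<close> supplies the letter \<open>k\<close> of these monomials, so that
  \<open>ractl_combination_in_I\<close> applies.\<close>

lemma ract_wedge_span_in_I:
  assumes y: "y \<in> fl.span ((\<lambda>p. wedge k (fst p) (snd p)) ` {p. snd p \<noteq> []} \<union> I)"
    and id: "\<And>\<phi>. L3_hom \<phi> \<Longrightarrow> \<phi> y $ 2 = 0"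
  shows "ract k y \<in> I"
proof -
  obtain g where "g \<in> fl.span ((\<lambda>p. wedge k (fst p) (snd p)) ` {p. snd p \<noteq> []})" and yg: "y - g \<in> I"
    using fl.subspace_span_Un[OF subspace y] by blast
  then obtain A d where A: "finite A" "A \<subseteq> {p. snd p \<noteq> []}"
    and g: "g = (\<Sum>p\<in>A. fl_scale (d p) (wedge k (fst p) (snd p)))"
    using fl.span_image_sum by blast
  have ract_term: "(\<Sum>p | p \<in> A \<and> fst p = l. fl_scale (d p) (ract k (wedge k (fst p) (snd p)))) \<in> I" for l
  proof (cases "l = k")
    case True
    then show ?thesis by (intro I_sum I_scale I_ract) (auto simp: wedge_self)
  next
    case False
    let ?S = "{p \<in> A. fst p = l}"
    have "(\<Sum>p\<in>?S. d p * monom_val (k # snd p) b) = 0" for b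
    proof -
      obtain \<phi> where \<phi>: "L3_hom \<phi>" "\<And>n. \<phi> (gen n) $ 1 = 0"
        "\<And>n. \<phi> (gen n) $ 2 = (if n = l then 1 else 0)" "\<And>n. \<phi> (gen n) $ 3 = b n"
        using ex_L3_hom[of "\<lambda>_. 0" "\<lambda>n. if n = l then 1 else 0" b] by blast
      have "\<phi> g = \<phi> y - \<phi> (y - g)" by (simp add: hom_linear[OF \<phi>(1)])
      then have "\<phi> g $ 2 = 0" using id[OF \<phi>(1)] hom_I[OF \<phi>(1) yg] by simp
      then have "0 = (\<Sum>p\<in>A. d p * \<phi> (wedge k (fst p) (snd p)) $ 2)"
        by (simp add: g hom_linear[OF \<phi>(1)])
      also have "\<dots> = (\<Sum>p\<in>A. if fst p = l then d p * monom_val (k # snd p) b else 0)"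
        using A(2) False by (intro sum.cong refl) (auto simp: hom_wedge[OF \<phi>(1)] \<phi>(3,4))
      also have "\<dots> = (\<Sum>p\<in>?S. d p * monom_val (k # snd p) b)"
        by (rule sum.inter_filter[symmetric]) (rule A(1))
      finally show ?thesis by simp
    qed
    then have "(\<Sum>p\<in>?S. fl_scale (d p) (ractl (k # snd p) (gen k \<cdot> gen l))) \<in> I"
      using A(1) by (intro ractl_combination_in_I) auto
    moreover have "fl_scale (d p) (ract k (wedge k (fst p) (snd p))) \<doteq>
        fl_scale (d p) (ractl (k # snd p) (gen k \<cdot> gen l))" if "p \<in> ?S" for p
    proof (rule cong_scale)
      have "ract k (wedge k (fst p) (snd p)) = ract k (ractl (snd p) (gen k \<cdot> gen l))"
        using that A(2) by (auto simp: wedge_def)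
      also have "\<dots> \<doteq> ractl (k # snd p) (gen k \<cdot> gen l)"
        by (simp add: ractl_ract cong_sym)
      finally show "ract k (wedge k (fst p) (snd p)) \<doteq> ractl (k # snd p) (gen k \<cdot> gen l)" .
    qed
    then have "(\<Sum>p\<in>?S. fl_scale (d p) (ract k (wedge k (fst p) (snd p)))) \<doteq>
        (\<Sum>p\<in>?S. fl_scale (d p) (ractl (k # snd p) (gen k \<cdot> gen l)))"
      unfolding cong_def sum_subtractf[symmetric] by (intro I_sum) blast
    ultimately show ?thesis using cong_in_I by blast
  qed
  have "ract k g = (\<Sum>p\<in>A. fl_scale (d p) (ract k (wedge k (fst p) (snd p))))"
    unfolding g by (induction A rule: infinite_finite_induct) (auto simp: ract_add ract_scale)
  also have "\<dots> = (\<Sum>l\<in>fst ` A. \<Sum>p | p \<in> A \<and> fst p = l. fl_scale (d p) (ract k (wedge k (fst p) (snd p))))"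
    by (rule sum.image_gen) fact
  also have "\<dots> \<in> I" by (intro I_sum ract_term)
  finally have "ract k g \<in> I" .
  moreover have "ract k y \<doteq> ract k g" using yg by (intro cong_ract) (simp add: cong_def)
  ultimately show ?thesis using cong_in_I by blast
qed

text \<open>Two applications of \<open>ract k\<close> lead into \<open>I\<close> by the separation
  argument. As one application acts on the square like q of them and q is at least 2, a single one
  is enough.\<close>

lemma ract_identity_in_I:
  assumes f: "f \<in> identities (*s) (L3_mul :: 'k ^ 3 \<Rightarrow> 'k ^ 3 \<Rightarrow> 'k ^ 3)"
    and span: "f \<in> fl.span (long_wedges \<union> I)"
  shows "ract k f \<in> I"
proof -
  have two: "ract k (ract k f) \<in> I"
  proof (rule ract_wedge_span_in_I[OF ract_in_span_wedge[OF span]])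
    fix \<phi> :: "'k free_leibniz \<Rightarrow> 'k ^ 3" assume \<phi>: "L3_hom \<phi>"
    with f have "\<phi> f = 0" by (rule identitiesD)
    then show "\<phi> (ract k f) $ 2 = 0" using hom_ract[OF \<phi>, of f] by simp
  qed
  obtain n where n: "q = Suc (Suc n)" using q_ge_2 by (metis add_2_eq_Suc le_Suc_ex)
  have "fl.span long_wedges \<subseteq> products"
    by (rule fl.span_minimal) (auto simp: long_wedges_def subspace_products)
  \<comment> \<open>\<open>ractl_power_q\<close> requires an element of the square itself, whereas
    \<open>f\<close> is one only modulo \<open>I\<close>.\<close>
  then obtain g where g: "g \<in> products" "f \<doteq> g"
    using fl.subspace_span_Un[OF subspace span] unfolding cong_def by blast
  have "ract k f \<doteq> ract k g" using g(2) by (rule cong_ract)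
  also have "\<dots> \<doteq> ractl (replicate q k) g" using g(1) ractl_power_q cong_sym by blast
  also have "\<dots> \<doteq> ractl (replicate q k) f" using g(2) cong_sym cong_ractl by blast
  also have "\<dots> = ractl (replicate n k) (ract k (ract k f))" by (simp only: n replicate_Suc fold_simps)
  finally show ?thesis using two I_ractl cong_in_I by blast
qed

text \<open>The product of the operators \<open>1 - x\<^sub>k\<^bsup>q-1\<^esup>\<close>, which are projections modulo \<open>I\<close> annihilating
  all multiples of \<open>x\<^sub>k\<close>.\<close>

primrec project :: "nat \<Rightarrow> 'k free_leibniz \<Rightarrow> 'k free_leibniz" where
  "project 0 z = z"
| "project (Suc n) z = project n z - ractl (replicate (q - 1) n) (project n z)"

lemma project_add: "project n (x + y) = project n x + project n y"
  by (induction n) (simp_all add: ractl_add algebra_simps del: fold_replicate)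

lemma project_scale: "project n (fl_scale c x) = fl_scale c (project n x)"
  by (induction n) (simp_all add: ractl_scale fl.scale_right_diff_distrib del: fold_replicate)

lemma project_mono:
  assumes "project n z \<in> I" "n \<le> m" shows "project m z \<in> I"
  using assms(2,1)
  by (induction rule: dec_induct) (simp_all add: I_diff I_ractl del: fold_replicate)

lemma project_products: "z \<in> products \<Longrightarrow> project n z \<in> products"
  by (induction n) (auto intro!: fl.subspace_diff subspace_products simp del: fold_replicate)

lemma project_ract:
  assumes "z \<in> products" shows "project n (ract k z) \<doteq> ract k (project n z)"
proof (induction n)
  case (Suc n)
  let ?R = "ractl (replicate (q - 1) n)"
  have "project (Suc n) (ract k z) \<doteq> ract k (project n z) - ?R (ract k (project n z))"
    by (simp only: project.simps) (intro cong_diff cong_ractl Suc)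
  also have "\<dots> \<doteq> ract k (project n z) - ract k (?R (project n z))"
    by (intro cong_diff cong_refl ractl_ract project_products assms)
  also have "\<dots> = ract k (project (Suc n) z)" by (simp add: ract_diff del: fold_replicate)
  finally show ?case .
qed simp

text \<open>The last factor of \<open>project (Suc k)\<close> is 1 - x_k^(q-1); it turns
  multiplication by x_k into x_k - x_k^q, which maps the square into \<open>I\<close>.\<close>

lemma project_Suc_ract:
  assumes "z \<in> products" shows "project (Suc k) (ract k z) \<in> I"
proof -
  let ?z = "project k z"
  have z: "?z \<in> products" using assms by (rule project_products)
  have q: "q = Suc (q - 1)" using q_ge_2 by simp
  have fold_q: "ractl (replicate (q - 1) k) (ract k ?z) = ractl (replicate q k) ?z"
    by (subst (2) q) (simp only: replicate_Suc fold_simps)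
  have "project (Suc k) (ract k z) \<doteq> ract k ?z - ractl (replicate q k) ?z"
    unfolding fold_q[symmetric] by (simp only: project.simps) (intro cong_diff cong_ractl project_ract assms)
  moreover have "ract k ?z - ractl (replicate q k) ?z \<in> I"
    using cong_sym[OF ractl_power_q[OF z, of k]] by (simp only: cong_def)
  ultimately show ?thesis by (rule cong_in_I)
qed

text \<open>A long wedge is a multiple of its last letter, so the factor for that letter kills it.
  For a sum, the larger of the two stages works.\<close>

lemma project_eventually_in_I:
  assumes "f \<in> fl.span (long_wedges \<union> I)"
  shows "\<exists>n. project n f \<in> I"
  using assms
proof (induction rule: fl.span_induct)
  case base
  show ?case unfolding fl.subspace_def
  proof safe
    show "\<exists>n. project n 0 \<in> I" by (rule exI[of _ 0]) simp
  next
    fix x y n m assume "project n x \<in> I" "project m y \<in> I"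
    then have "project (max n m) x \<in> I" "project (max n m) y \<in> I"
      by (auto intro: project_mono)
    then show "\<exists>n. project n (x + y) \<in> I" by (intro exI[of _ "max n m"]) (simp add: project_add I_add)
  next
    fix c x n assume "project n x \<in> I"
    then show "\<exists>n. project n (fl_scale c x) \<in> I"
      by (intro exI[of _ n]) (simp add: project_scale I_scale)
  qed
next
  case (step f)
  then show ?case
  proof
    assume "f \<in> long_wedges"
    then obtain i j ks where f: "f = wedge i j ks" and ks: "ks \<noteq> []" by (auto simp: long_wedges_def)
    obtain ms k where "ks = ms @ [k]" using ks by (cases ks rule: rev_cases) auto
    then have "f = ract k (ractl ms (gen i \<cdot> gen j))" unfolding f wedge_def by simp
    then show ?case
      using project_Suc_ract[of "ractl ms (gen i \<cdot> gen j)" k] by (intro exI[of _ "Suc k"]) simp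
  next
    assume "f \<in> I"
    then show ?case by (intro exI[of _ 0]) simp
  qed
qed

text \<open>Since q - 1 is positive, each new factor changes \<open>f\<close> only by a multiple of
  \<open>ract n f\<close>, which lies in \<open>I\<close>. So \<open>f\<close> is congruent to all
  its projections, one of which lies in \<open>I\<close>.\<close>

lemma finite_identity_in_I:
  assumes f: "f \<in> identities (*s) (L3_mul :: 'k ^ 3 \<Rightarrow> 'k ^ 3 \<Rightarrow> 'k ^ 3)"
  shows "f \<in> I"
proof -
  have span: "f \<in> fl.span (long_wedges \<union> I)"
    using identity_in_span_wedges[OF f] span_wedges_le by blast
  obtain m where m: "q - 1 = Suc m" using q_ge_2 by (cases "q - 1") auto
  have "f \<doteq> project n f" for n
  proof (induction n)
    case (Suc n)
    have "ractl (replicate (q - 1) n) f \<in> I"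
      unfolding m replicate_Suc fold_simps by (intro I_ractl ract_identity_in_I f span)
    with cong_ractl[OF cong_sym[OF Suc]] have "ractl (replicate (q - 1) n) (project n f) \<in> I"
      by (rule cong_in_I)
    then have "project n f \<doteq> project (Suc n) f" by (simp add: cong_def del: fold_replicate)
    with Suc show ?case by (rule cong_trans)
  qed simp
  with project_eventually_in_I[OF span] show ?thesis using cong_in_I by blast
qed

end


section \<open>The two inclusions\<close>

lemma T_ideal_subst:
  fixes y :: "nat \<Rightarrow> 'k::field free_leibniz"
  assumes "T_ideal I"
  obtains \<psi> where "\<And>f. f \<in> I \<Longrightarrow> \<psi> f \<in> I" "algebra_hom fl_scale fl_mul fl_scale fl_mul \<psi>" "\<And>n. \<psi> (gen n) = y n"
proof -
  obtain \<psi> where "algebra_hom fl_scale fl_mul fl_scale fl_mul \<psi>" "\<forall>n. \<psi> (gen n) = y n"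
    using free_leibniz_universal[OF fl.leibniz_algebra_axioms, of y] by blast
  moreover from this(1) assms have "\<psi> ` I \<subseteq> I" unfolding T_ideal_def by blast
  ultimately show thesis using that[of \<psi>] by blast
qed

lemma algebra_hom_simps:
  assumes "algebra_hom fl_scale fl_mul fl_scale fl_mul \<psi>"
  shows "\<psi> (x + y) = \<psi> x + \<psi> y" "\<psi> (x - y) = \<psi> x - \<psi> y" "\<psi> (fl_scale c x) = fl_scale c (\<psi> x)"
    "\<psi> (x \<cdot> y) = \<psi> x \<cdot> \<psi> y" "\<psi> (rmul_pow x y n) = rmul_pow (\<psi> x) (\<psi> y) n"
proof -
  have "module_hom fl_scale fl_scale \<psi>" using assms by (simp add: algebra_hom_def module_hom_iff_linear)
  note this[THEN module_hom.add, simp] this[THEN module_hom.diff, simp] this[THEN module_hom.scale, simp]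
  show "\<psi> (x + y) = \<psi> x + \<psi> y" "\<psi> (x - y) = \<psi> x - \<psi> y" "\<psi> (fl_scale c x) = fl_scale c (\<psi> x)"
    by simp_all
  show mul: "\<psi> (x \<cdot> y) = \<psi> x \<cdot> \<psi> y" for x y using assms by (simp add: algebra_hom_def)
  show "\<psi> (rmul_pow x y n) = rmul_pow (\<psi> x) (\<psi> y) n"
    by (induction n) (simp_all add: rmul_pow_def mul)
qed

lemma algebra_hom_comp:
  assumes "algebra_hom s1 m1 s2 m2 \<psi>" "algebra_hom s2 m2 s3 m3 \<phi>"
  shows "algebra_hom s1 m1 s3 m3 (\<phi> \<circ> \<psi>)"
  using assms Vector_Spaces.linear_compose[of s1 s2 \<psi> s3 \<phi>] unfolding algebra_hom_def by auto

text \<open>Composing an endomorphism with a substitution into \<open>L3\<close> gives another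
  substitution, whence the invariance.\<close>

lemma T_ideal_identities: "T_ideal (identities (*s) (L3_mul :: 'k::field ^ 3 \<Rightarrow> 'k ^ 3 \<Rightarrow> 'k ^ 3))"
proof -
  let ?J = "identities (*s) (L3_mul :: 'k ^ 3 \<Rightarrow> 'k ^ 3 \<Rightarrow> 'k ^ 3)"
  have J: "f \<in> ?J" if "\<And>\<phi> :: 'k free_leibniz \<Rightarrow> 'k ^ 3. L3_hom \<phi> \<Longrightarrow> \<phi> f = 0" for f
    using that by (simp add: identities_def)
  have "fl.ideal ?J"
    unfolding fl.ideal_def fl.subspace_def
  proof (intro conjI ballI allI)
    show "0 \<in> ?J" by (rule J) (simp add: hom_linear)
  next
    fix x y assume xy: "x \<in> ?J" "y \<in> ?J"
    show "x + y \<in> ?J"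
      by (rule J) (simp add: hom_linear identitiesD[OF xy(1)] identitiesD[OF xy(2)])
  next
    fix c x assume x: "x \<in> ?J"
    show "fl_scale c x \<in> ?J"
      by (rule J) (simp add: hom_linear identitiesD[OF x])
  next
    fix a x assume a: "a \<in> ?J"
    show "a \<cdot> x \<in> ?J" "x \<cdot> a \<in> ?J"
      by (rule J, simp add: hom_mult identitiesD[OF a])+
  qed
  moreover have "\<psi> f \<in> ?J" if \<psi>: "algebra_hom fl_scale fl_mul fl_scale fl_mul \<psi>" and "f \<in> ?J" for \<psi> f
  proof (rule J)
    fix \<phi> :: "'k free_leibniz \<Rightarrow> 'k ^ 3" assume "L3_hom \<phi>"
    with \<psi> have "L3_hom (\<phi> \<circ> \<psi>)" by (rule algebra_hom_comp)
    from identitiesD[OF \<open>f \<in> ?J\<close> this] show "\<phi> (\<psi> f) = 0" by simp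
  qed
  ultimately show ?thesis unfolding T_ideal_def by blast
qed


section \<open>The generating polynomials vanish on \<open>L3\<close>\<close>

lemma identitiesI: "(\<And>\<phi>. L3_hom \<phi> \<Longrightarrow> \<phi> f = 0) \<Longrightarrow> f \<in> identities (*s) L3_mul"
  by (simp add: identities_def)

lemma S1_identities: "S1 \<subseteq> identities (*s) (L3_mul :: 'k::field ^ 3 \<Rightarrow> 'k ^ 3 \<Rightarrow> 'k ^ 3)"
  unfolding S1_def
  by (intro insert_subsetI empty_subsetI identitiesI)
    (simp_all add: hom_linear hom_mult vec_eq_iff forall_3 L3_mul_nth algebra_simps)

text \<open>The sum x_1x_2 + x_2x_1 has e_1-coordinate 2 b_1 b_2, where the characteristic
  enters.\<close>

lemma S2_identities:
  assumes "CHAR('k::field) = 2"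
  shows "S2 \<subseteq> identities (*s) (L3_mul :: 'k ^ 3 \<Rightarrow> 'k ^ 3 \<Rightarrow> 'k ^ 3)"
proof -
  have "(2::'k) = 0" using assms two_neq_0_iff by blast
  then show ?thesis
    unfolding S2_def
    by (intro insert_subsetI empty_subsetI identitiesI)
      (simp_all add: hom_linear hom_mult vec_eq_iff forall_3 L3_mul_nth)
qed

text \<open>Splitting off one factor lets the others act on a product, whose value has third
  coordinate 0 as \<open>hom_rmul_pow\<close> requires.\<close>

lemma rmul_pow_pos: "n > 0 \<Longrightarrow> x \<cdot> y\<^bsup>(n)\<^esup> = (x \<cdot> y) \<cdot> y\<^bsup>(n - 1)\<^esup>"
  by (cases n) (simp_all only: rmul_pow_def funpow_Suc_right comp_apply diff_Suc_1)

lemma hom_rmul_pow: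
  assumes "L3_hom \<phi>" "\<phi> u $ 3 = 0"
  shows "\<phi> (u \<cdot> gen k\<^bsup>(n)\<^esup>) $ 1 = (if n = 0 then \<phi> u $ 1 else 0)"
    and "\<phi> (u \<cdot> gen k\<^bsup>(n)\<^esup>) $ 2 = \<phi> u $ 2 * (- \<phi> (gen k) $ 3) ^ n"
    and "\<phi> (u \<cdot> gen k\<^bsup>(n)\<^esup>) $ 3 = 0"
proof -
  have "\<phi> (u \<cdot> gen k\<^bsup>(n)\<^esup>) $ 1 = (if n = 0 then \<phi> u $ 1 else 0) \<and>
      \<phi> (u \<cdot> gen k\<^bsup>(n)\<^esup>) $ 2 = \<phi> u $ 2 * (- \<phi> (gen k) $ 3) ^ n \<and> \<phi> (u \<cdot> gen k\<^bsup>(n)\<^esup>) $ 3 = 0"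
    using assms(2)
    by (induction n) (simp_all add: rmul_pow_def hom_mult[OF assms(1)] L3_mul_nth algebra_simps)
  then show "\<phi> (u \<cdot> gen k\<^bsup>(n)\<^esup>) $ 1 = (if n = 0 then \<phi> u $ 1 else 0)"
    "\<phi> (u \<cdot> gen k\<^bsup>(n)\<^esup>) $ 2 = \<phi> u $ 2 * (- \<phi> (gen k) $ 3) ^ n"
    "\<phi> (u \<cdot> gen k\<^bsup>(n)\<^esup>) $ 3 = 0" by simp_all
qed

text \<open>After splitting q-th powers, every remaining power has exponent q - 1. It kills the
  e_1-coordinate and multiplies the e_2-coordinate by 0 or 1 according to whether the third
  coordinate of its base vanishes.\<close>

lemma S_fin_identities:
  assumes "finite (UNIV :: 'k::field set)"
  shows "S_fin CARD('k) \<subseteq> identities (*s) (L3_mul :: 'k ^ 3 \<Rightarrow> 'k ^ 3 \<Rightarrow> 'k ^ 3)"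
proof -
  define q where "q = CARD('k)"
  have q: "q \<ge> 2" "(- c) ^ (q - 1) = (if c = 0 then 0 else 1)" for c :: 'k
    using finite_field_fermat[OF assms] by (auto simp: q_def)
  then have pos: "0 < q" "\<not> q \<le> 1" by auto
  show ?thesis
    unfolding S_fin_def q_def[symmetric] rmul_pow_pos[OF \<open>0 < q\<close>]
    by (intro insert_subsetI empty_subsetI identitiesI)
      (simp_all add: vec_eq_iff forall_3 hom_linear hom_mult hom_rmul_pow L3_mul_nth q pos
        del: One_nat_def)
qed

section \<open>The generated T-ideals meet the conditions of the reduction\<close>

lemma T_ideal_S1_instances:
  fixes I :: "'k::field free_leibniz set"
  assumes "T_ideal I" "S1 \<subseteq> I"
  shows "x \<cdot> y \<cdot> z + y \<cdot> x \<cdot> z \<in> I" "z \<cdot> x \<cdot> y - z \<cdot> y \<cdot> x - y \<cdot> x \<cdot> z \<in> I"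
    "(x \<cdot> y) \<cdot> (z \<cdot> w) \<in> I"
proof -
  obtain \<psi> where \<psi>: "\<And>f. f \<in> I \<Longrightarrow> \<psi> f \<in> I" "algebra_hom fl_scale fl_mul fl_scale fl_mul \<psi>"
    "\<And>n. \<psi> (gen n) = (if n = 0 then x else if n = 1 then y else if n = 2 then z else w)"
    using T_ideal_subst[OF assms(1), of "\<lambda>n. if n = 0 then x else if n = 1 then y else if n = 2 then z else w"]
    by blast
  have "\<psi> ` S1 \<subseteq> I" using \<psi>(1) assms(2) by blast
  then show "x \<cdot> y \<cdot> z + y \<cdot> x \<cdot> z \<in> I" "z \<cdot> x \<cdot> y - z \<cdot> y \<cdot> x - y \<cdot> x \<cdot> z \<in> I"
    "(x \<cdot> y) \<cdot> (z \<cdot> w) \<in> I"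
    by (simp_all add: S1_def algebra_hom_simps[OF \<psi>(2)] \<psi>(3))
qed

lemma T_ideal_S2_instances:
  fixes I :: "'k::field free_leibniz set"
  assumes "T_ideal I" "S2 \<subseteq> I"
  shows "x \<cdot> y + y \<cdot> x \<in> I" "(x \<cdot> y) \<cdot> (z \<cdot> w) \<in> I"
proof -
  obtain \<psi> where \<psi>: "\<And>f. f \<in> I \<Longrightarrow> \<psi> f \<in> I" "algebra_hom fl_scale fl_mul fl_scale fl_mul \<psi>"
    "\<And>n. \<psi> (gen n) = (if n = 0 then x else if n = 1 then y else if n = 2 then z else w)"
    using T_ideal_subst[OF assms(1), of "\<lambda>n. if n = 0 then x else if n = 1 then y else if n = 2 then z else w"]
    by blast
  have "\<psi> ` S2 \<subseteq> I" using \<psi>(1) assms(2) by blast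
  then show "x \<cdot> y + y \<cdot> x \<in> I" "(x \<cdot> y) \<cdot> (z \<cdot> w) \<in> I"
    by (simp_all add: S2_def algebra_hom_simps[OF \<psi>(2)] \<psi>(3))
qed

lemma T_ideal_S_fin_instances:
  fixes I :: "'k::field free_leibniz set"
  assumes "T_ideal I" "S_fin q \<subseteq> I"
  shows "x \<cdot> y - y \<cdot> x + fl_scale 2 (y \<cdot> x \<cdot> y\<^bsup>(q - 1)\<^esup>) + fl_scale 2 (y \<cdot> x\<^bsup>(q)\<^esup>)
      - fl_scale 2 (y \<cdot> x\<^bsup>(q)\<^esup> \<cdot> y\<^bsup>(q - 1)\<^esup>) \<in> I"
    and "x \<cdot> y \<cdot> z\<^bsup>(q)\<^esup> - x \<cdot> y \<cdot> z \<in> I"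
proof -
  obtain \<psi> where \<psi>: "\<And>f. f \<in> I \<Longrightarrow> \<psi> f \<in> I" "algebra_hom fl_scale fl_mul fl_scale fl_mul \<psi>"
    "\<And>n. \<psi> (gen n) = (if n = 0 then x else if n = 1 then y else z)"
    using T_ideal_subst[OF assms(1), of "\<lambda>n. if n = 0 then x else if n = 1 then y else z"]
    by blast
  have "\<psi> ` S_fin q \<subseteq> I" using \<psi>(1) assms(2) by blast
  then show "x \<cdot> y - y \<cdot> x + fl_scale 2 (y \<cdot> x \<cdot> y\<^bsup>(q - 1)\<^esup>) + fl_scale 2 (y \<cdot> x\<^bsup>(q)\<^esup>)
      - fl_scale 2 (y \<cdot> x\<^bsup>(q)\<^esup> \<cdot> y\<^bsup>(q - 1)\<^esup>) \<in> I" "x \<cdot> y \<cdot> z\<^bsup>(q)\<^esup> - x \<cdot> y \<cdot> z \<in> I"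
    unfolding S_fin_def by (simp_all add: algebra_hom_simps[OF \<psi>(2)] \<psi>(3) del: One_nat_def)
qed

lemma L3_ideal_S1:
  fixes I :: "'k::field free_leibniz set"
  assumes "CHAR('k) \<noteq> 2" "T_ideal I" "S1 \<subseteq> I"
    and "I \<subseteq> identities (*s) (L3_mul :: 'k ^ 3 \<Rightarrow> 'k ^ 3 \<Rightarrow> 'k ^ 3)"
  shows "L3_ideal I"
proof
  note inst = T_ideal_S1_instances[OF assms(2,3)]
  show ideal: "fl.ideal I" using assms(2) by (simp add: T_ideal_def)
  fix x y z w :: "'k free_leibniz"
  show "(x \<cdot> y) \<cdot> (z \<cdot> w) \<in> I" "x \<cdot> y \<cdot> z + y \<cdot> x \<cdot> z \<in> I" "z \<cdot> x \<cdot> y - z \<cdot> y \<cdot> x - y \<cdot> x \<cdot> z \<in> I"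
    by (rule inst)+
  have "(2::'k) \<noteq> 0" using assms(1) by (simp add: two_neq_0_iff)
  \<comment> \<open>Half of the antisymmetry instance with equal first arguments.\<close>
  then have "x \<cdot> x \<cdot> y = fl_scale (1 / 2) (x \<cdot> x \<cdot> y + x \<cdot> x \<cdot> y)"
    by (simp add: fl.scale_right_distrib flip: fl.scale_left_distrib)
  also have "\<dots> \<in> I"
    using inst(1)[of x x y] ideal by (simp only: fl.ideal_def fl.subspace_def)
  finally show "x \<cdot> x \<cdot> y \<in> I" .
  show "x \<cdot> y - y \<cdot> x \<in> I" if "CHAR('k) = 2" using that assms(1) by simp
qed (fact assms)

lemma L3_ideal_S2:
  fixes I :: "'k::field free_leibniz set"
  assumes "CHAR('k) = 2" "T_ideal I" "S2 \<subseteq> I"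
    and "I \<subseteq> identities (*s) (L3_mul :: 'k ^ 3 \<Rightarrow> 'k ^ 3 \<Rightarrow> 'k ^ 3)"
  shows "L3_ideal I"
proof
  note inst = T_ideal_S2_instances[OF assms(2,3)]
  show ideal: "fl.ideal I" using assms(2) by (simp add: T_ideal_def)
  then have sub: "fl.subspace I" and mul: "a \<in> I \<Longrightarrow> a \<cdot> b \<in> I" for a b
    by (auto simp: fl.ideal_def)
  have "(2::'k) = 0" using assms(1) two_neq_0_iff by blast
  have double: "u + u = 0" for u :: "'k free_leibniz"
    using fl.scale_left_distrib[of 1 1 u] \<open>(2::'k) = 0\<close> by simp
  fix x y z w :: "'k free_leibniz"
  show "(x \<cdot> y) \<cdot> (z \<cdot> w) \<in> I" by (rule inst)
  show "x \<cdot> y \<cdot> z + y \<cdot> x \<cdot> z \<in> I"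
    using mul[OF inst(1)[of x y], of z] by (simp add: fl.mul_add_left)
  \<comment> \<open>The Leibniz rule makes \<open>y \<cdot> (x \<cdot> x)\<close> zero, so this is
    the anticommutativity instance for \<open>y\<close> and \<open>x \<cdot> x\<close>.\<close>
  have "x \<cdot> x \<cdot> y = y \<cdot> (x \<cdot> x) + x \<cdot> x \<cdot> y" by (simp add: fl.leibniz)
  then show "x \<cdot> x \<cdot> y \<in> I" using inst(1)[of y "x \<cdot> x"] by simp
  \<comment> \<open>The first two terms are \<open>z \<cdot> (x \<cdot> y)\<close> by the Leibniz
    rule; adding and subtracting \<open>x \<cdot> y \<cdot> z\<close> produces two anticommutativity
    instances, one multiplied by \<open>z\<close>.\<close>
  have "z \<cdot> x \<cdot> y - z \<cdot> y \<cdot> x - y \<cdot> x \<cdot> z = (z \<cdot> (x \<cdot> y) + x \<cdot> y \<cdot> z) - (x \<cdot> y + y \<cdot> x) \<cdot> z"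
    by (simp add: fl.leibniz fl.mul_add_left)
  also have "\<dots> \<in> I" by (intro fl.subspace_diff sub mul inst)
  finally show "z \<cdot> x \<cdot> y - z \<cdot> y \<cdot> x - y \<cdot> x \<cdot> z \<in> I" .
  have "y \<cdot> x = - (y \<cdot> x)" using double by (simp only: add_eq_0_iff)
  then show "x \<cdot> y - y \<cdot> x \<in> I" using inst(1)[of x y] by (metis diff_conv_add_uminus)
qed (fact assms)

text \<open>The harder inclusion may use the easy one, because \<open>L3_ideal\<close> contains it
  among its conditions.\<close>

lemma hull_eq_identitiesI:
  assumes "S \<subseteq> identities (*s) (L3_mul :: 'k::field ^ 3 \<Rightarrow> 'k ^ 3 \<Rightarrow> 'k ^ 3)"
    and "\<And>f. f \<in> identities (*s) (L3_mul :: 'k ^ 3 \<Rightarrow> 'k ^ 3 \<Rightarrow> 'k ^ 3) \<Longrightarrow>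
      T_ideal hull S \<subseteq> identities (*s) (L3_mul :: 'k ^ 3 \<Rightarrow> 'k ^ 3 \<Rightarrow> 'k ^ 3) \<Longrightarrow> f \<in> T_ideal hull S"
  shows "T_ideal hull S = identities (*s) (L3_mul :: 'k ^ 3 \<Rightarrow> 'k ^ 3 \<Rightarrow> 'k ^ 3)"
proof -
  have "T_ideal hull S \<subseteq> identities (*s) (L3_mul :: 'k ^ 3 \<Rightarrow> 'k ^ 3 \<Rightarrow> 'k ^ 3)"
    using assms(1) T_ideal_identities by (rule hull_minimal)
  with assms(2) show ?thesis by blast
qed


theorem theorem3p8:
  shows
    "(infinite (UNIV :: 'k::field set) \<longrightarrow>
        (CHAR('k) \<noteq> 2 \<longrightarrow>
           T_ideal hull S1 = identities (*s) (L3_mul :: 'k ^ 3 \<Rightarrow> 'k ^ 3 \<Rightarrow> 'k ^ 3)) \<and>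
        (CHAR('k) = 2 \<longrightarrow>
           T_ideal hull S2 = identities (*s) (L3_mul :: 'k ^ 3 \<Rightarrow> 'k ^ 3 \<Rightarrow> 'k ^ 3))) \<and>
     (\<forall>q. finite (UNIV :: 'k set) \<and> CARD('k) = q \<longrightarrow>
        (CHAR('k) \<noteq> 2 \<longrightarrow>
           T_ideal hull (S1 \<union> S_fin q) = identities (*s) (L3_mul :: 'k ^ 3 \<Rightarrow> 'k ^ 3 \<Rightarrow> 'k ^ 3)) \<and>
        (CHAR('k) = 2 \<longrightarrow>
           T_ideal hull (S2 \<union> S_fin q) = identities (*s) (L3_mul :: 'k ^ 3 \<Rightarrow> 'k ^ 3 \<Rightarrow> 'k ^ 3)))"
proof -
  let ?J = "identities (*s) (L3_mul :: 'k ^ 3 \<Rightarrow> 'k ^ 3 \<Rightarrow> 'k ^ 3)"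
  \<comment> \<open>The characteristic matters only for which \<open>S\<close> makes the hull an
    \<open>L3_ideal\<close>, so each size of field is treated with \<open>S\<close>
    arbitrary.\<close>
  have infinite_case: "T_ideal hull S = ?J"
    if "infinite (UNIV :: 'k set)" "S \<subseteq> ?J"
      and "T_ideal hull S \<subseteq> ?J \<Longrightarrow> L3_ideal (T_ideal hull S)" for S
    by (rule hull_eq_identitiesI[OF that(2)]) (rule L3_ideal.infinite_identity_in_I[OF that(3,1)])
  have finite_case: "T_ideal hull (S \<union> S_fin q) = ?J"
    if fin: "finite (UNIV :: 'k set)" and q: "CARD('k) = q" and S: "S \<subseteq> ?J"
      and ideal: "T_ideal hull (S \<union> S_fin q) \<subseteq> ?J \<Longrightarrow> L3_ideal (T_ideal hull (S \<union> S_fin q))" for S q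
  proof (rule hull_eq_identitiesI)
    show "S \<union> S_fin q \<subseteq> ?J" using S S_fin_identities[OF fin] by (simp only: q Un_least)
  next
    fix f assume f: "f \<in> ?J" and "T_ideal hull (S \<union> S_fin q) \<subseteq> ?J"
    then interpret L3_ideal "T_ideal hull (S \<union> S_fin q)" by (intro ideal)
    have "S_fin q \<subseteq> T_ideal hull (S \<union> S_fin q)" using hull_subset[of "S \<union> S_fin q"] by blast
    note inst = T_ideal_S_fin_instances[OF T_ideal_hull this]
    interpret finite_L3_ideal "T_ideal hull (S \<union> S_fin q)" q
      by unfold_locales (use fin q inst in auto)
    show "f \<in> T_ideal hull (S \<union> S_fin q)" using f by (rule finite_identity_in_I)
  qed
  have hull: "S \<subseteq> T_ideal hull S" "S \<subseteq> T_ideal hull (S \<union> S')" for S S' :: "'k free_leibniz set"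
    using hull_subset[of S T_ideal] hull_subset[of "S \<union> S'" T_ideal] by blast+
  note S1_ideal = L3_ideal_S1[OF _ T_ideal_hull] and S2_ideal = L3_ideal_S2[OF _ T_ideal_hull]
  show ?thesis
  proof (intro conjI impI allI)
    assume inf: "infinite (UNIV :: 'k set)"
    show "T_ideal hull S1 = ?J" if "CHAR('k) \<noteq> 2"
      using infinite_case[OF inf S1_identities] S1_ideal[OF that hull(1)] by blast
    show "T_ideal hull S2 = ?J" if "CHAR('k) = 2"
      using infinite_case[OF inf S2_identities[OF that]] S2_ideal[OF that hull(1)] by blast
  next
    fix q assume q: "finite (UNIV :: 'k set) \<and> CARD('k) = q"
    show "T_ideal hull (S1 \<union> S_fin q) = ?J" if "CHAR('k) \<noteq> 2"
      using finite_case[OF conjunct1[OF q] conjunct2[OF q] S1_identities] S1_ideal[OF that hull(2)]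
      by blast
    show "T_ideal hull (S2 \<union> S_fin q) = ?J" if "CHAR('k) = 2"
      using finite_case[OF conjunct1[OF q] conjunct2[OF q] S2_identities[OF that]] S2_ideal[OF that hull(2)]
      by blast
  qed
qed

end
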